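(* Let $\alpha\in(0,1)$. The functional $J_{\lambda,\alpha}$ has the Fréchet derivative $J_{\lambda,\alpha}'(y)$ at each point $y\in B(2R,f_0,f_1)$. Moreover, there exist a number $\lambda_1=\lambda_1(R,F,N)>1$ and a number $C_1=C_1(R,F,N)>0$, depending only on the listed parameters, such that for all $\lambda\ge\lambda_1$ the functional $J_{\lambda,\alpha}$ is strictly convex on the set $\overline{B(R,f_0,f_1)}$; that is, for all $y_{(1)},y_{(2)}\in\overline{B(R,f_0,f_1)}$ $$J_{\lambda,\alpha}(y_{(2)})-J_{\lambda,\alpha}(y_{(1)})-J_{\lambda,\alpha}'(y_{(1)})(y_{(2)}-y_{(1)})\ \ge\ C_1\,\|y_{(2)}-y_{(1)}\|_{H^2(0,1)}^2 .$$
   Context: Basis. Let $0<\underline{k}<\overline{k}<\infty$. Let $\{\varphi_n\}_{n\ge0}$ be the orthonormal basis of $L_2(0,1)$ obtained by applying Gram–Schmidt orthonormalization to $\{k^ne^k\}_{n\ge 0}$ in the order $n=0,1,2,\dots$, and let $\psi_n(k)=(\overline{k}-\underline{k})^{-1/2}\varphi_n\big((k-\underline{k})/(\overline{k}-\underline{k})\big)$, a real-valued orthonormal basis of $L_2(\underline{k},\overline{k})$. For an integer $N\ge1$ let $M_N=(a_{mn})_{m,n=0}^{N-1}$, $a_{mn}=\int_{\underline{k}}^{\overline{k}}\psi_n'\psi_m\,dk$; this matrix is upper triangular and invertible. The map $F$. For $z=(z_0,\dots,z_{N-1})^T\in\mathbb{C}^N$ let $\widetilde F(z)\in\mathbb{C}^N$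 have components, $s=0,\dots,N-1$, $$\widetilde F_s(z)=\sum_{n,m=0}^{N-1}z_nz_m\int_{\underline{k}}^{\overline{k}}\big(2k^2\psi_n'\psi_m+2k\psi_n\psi_m\big)\psi_s\,dk-2i\sum_{n=0}^{N-1}z_n\int_{\underline{k}}^{\overline{k}}\big(k\psi_n'+\psi_n\big)\psi_s\,dk,$$ and $F(z)=M_N^{-1}\widetilde F(z)$. Spaces and sets. $H^2(0,1)$ denotes the space of $\mathbb{C}^N$-valued $H^2$ functions on $(0,1)$, regarded as a real Hilbert space (pairs of real and imaginary parts). $H_0^2(0,1)=\{w\in H^2(0,1): w(0)=w'(0)=w'(1)=0\}$. Let $f_0,f_1\in\mathbb{C}^N$ be the given boundary data. Let $\chi\in C^2[0,1]$ be a fixed cut-off function with $\chi=1$ on $[0,1/2]$, $\chi=0$ on $[3/4,1]$, $\chi\in(0,1)$ on $(1/2,3/4)$, and $f(x)=[f_0+xf_1]\chi(x)$. For $R>0$ arbitrary, $$B(R,f_0,f_1)=\{W\in H^2(0,1): W(0)=f_0,\ W'(0)=f_1,\ W'(1)=0,\ \|W-f\|_{H^2(0,1)}<R\}.$$ Overlines denote closures in $H^2(0,1)$. Functional. For $\lambda\ge 1$, $\alpha\in(0,1)$, $$J_{\lambda,\alpha}(y)=e^{2\lambda}\int_0^1|y''+F(y')|^2e^{-2\lambda x}\,dx+\alpha\|y\|_{H^2(0,1)}^2 .$$ The Fréchet derivative $J_{\lambda,\alpha}'(y)$ is taken with respect to increments $h\in H_0^2(0,1)$ (real-linear) and is identified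 by the Riesz theorem with an element of $H_0^2(0,1)$; $J'_{\lambda,\alpha}(y)(h)$ is its value on $h$.
   Formalization: The number λ_1 is allowed to depend also on the given boundary data f_0, f_1 and the fixed cut-off function χ, since a λ_1 depending only on R, F, N fails for large boundary data; C_1 depends only on the listed parameters. *)

theory Defs
  imports "HOL-Analysis.Analysis"
begin

section \<open>The basis\<close>

definition L2_inner01 :: "(real \<Rightarrow> real) \<Rightarrow> (real \<Rightarrow> real) \<Rightarrow> real" where
  "L2_inner01 u v = integral {0..1} (\<lambda>x. u x * v x)"

definition gen :: "nat \<Rightarrow> real \<Rightarrow> real" where
  "gen n k = k ^ n * exp k"

declare sum.cong [fundef_cong]

fun phi :: "nat \<Rightarrow> real \<Rightarrow> real" where
  "phi n = (let v = (\<lambda>k. gen n k - (\<Sum>j<n. L2_inner01 (gen n) (phi j) * phi j k))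
            in (\<lambda>k. v k / sqrt (L2_inner01 v v)))"

declare phi.simps [simp del]

definition psi :: "real \<Rightarrow> real \<Rightarrow> nat \<Rightarrow> real \<Rightarrow> real" where
  "psi klo khi n k = (khi - klo) powr (- 1 / 2) * phi n ((k - klo) / (khi - klo))"


section \<open>The map F\<close>

text \<open>
  The components of \<open>\<complex>\<^sup>N\<close> are indexed by a finite linearly ordered type with \<open>N\<close> elements;
  \<open>idx\<close> is its order isomorphism onto \<open>{0,\<dots>,N-1}\<close>.
\<close>

definition idx :: "'n::{finite,linorder} \<Rightarrow> nat" where
  "idx i = card {j. j < i}"

definition M_mat :: "real \<Rightarrow> real \<Rightarrow> complex ^ 'n::{finite,linorder} ^ 'n::{finite,linorder}" where
  "M_mat klo khi = (\<chi> m n. complex_of_real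
     (integral {klo..khi} (\<lambda>k. deriv (psi klo khi (idx n)) k * psi klo khi (idx m) k)))"

definition F_tilde :: "real \<Rightarrow> real \<Rightarrow> complex ^ 'n::{finite,linorder} \<Rightarrow> complex ^ 'n::{finite,linorder}" where
  "F_tilde klo khi z = (\<chi> s.
     (\<Sum>n\<in>UNIV. \<Sum>m\<in>UNIV. z $ n * z $ m * complex_of_real (integral {klo..khi} (\<lambda>k.
        (2 * k\<^sup>2 * deriv (psi klo khi (idx n)) k * psi klo khi (idx m) k
          + 2 * k * psi klo khi (idx n) k * psi klo khi (idx m) k) * psi klo khi (idx s) k)))
     - 2 * \<i> * (\<Sum>n\<in>UNIV. z $ n * complex_of_real (integral {klo..khi} (\<lambda>k.
        (k * deriv (psi klo khi (idx n)) k + psi klo khi (idx n) k) * psi klo khi (idx s) k))))"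

definition F_map :: "real \<Rightarrow> real \<Rightarrow> complex ^ 'n::{finite,linorder} \<Rightarrow> complex ^ 'n::{finite,linorder}" where
  "F_map klo khi z = matrix_inv (M_mat klo khi) *v F_tilde klo khi z"


section \<open>Sobolev spaces on (0,1)\<close>

text \<open>
  Elements of \<open>L\<^sub>2\<close>, \<open>H\<^sup>1\<close>, \<open>H\<^sup>2\<close> are represented by functions on the real line; only their
  values almost everywhere on \<open>(0,1)\<close> matter, and all notions below respect equality
  almost everywhere. Weak derivatives are tested, as in Brezis, against \<open>C\<^sup>1\<close> functions with
  compact support in \<open>(0,1)\<close>.
\<close>

abbreviation I01 :: "real measure" where
  "I01 \<equiv> lebesgue_on {0<..<1}"

definition L2 :: "(real \<Rightarrow> 'a::euclidean_space) set" where
  "L2 = {u. u \<in> borel_measurable I01 \<and> integrable I01 (\<lambda>x. (norm (u x))\<^sup>2)}"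

definition test_fun :: "(real \<Rightarrow> real) \<Rightarrow> bool" where
  "test_fun p \<longleftrightarrow> (\<forall>x. p differentiable at x) \<and> continuous_on UNIV (deriv p) \<and>
     (\<exists>a b. 0 < a \<and> b < 1 \<and> (\<forall>x. x \<notin> {a..b} \<longrightarrow> p x = 0))"

definition has_weak_deriv :: "(real \<Rightarrow> 'a::euclidean_space) \<Rightarrow> (real \<Rightarrow> 'a) \<Rightarrow> bool" where
  "has_weak_deriv u v \<longleftrightarrow>
     (\<forall>p. test_fun p \<longrightarrow> (LINT x|I01. deriv p x *\<^sub>R u x) = - (LINT x|I01. p x *\<^sub>R v x))"

definition H1 :: "(real \<Rightarrow> 'a::euclidean_space) set" where
  "H1 = {u \<in> L2. \<exists>v\<in>L2. has_weak_deriv u v}"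

definition wderiv :: "(real \<Rightarrow> 'a::euclidean_space) \<Rightarrow> real \<Rightarrow> 'a" where
  "wderiv u = (SOME v. v \<in> L2 \<and> has_weak_deriv u v)"

definition H2 :: "(real \<Rightarrow> 'a::euclidean_space) set" where
  "H2 = {u \<in> H1. wderiv u \<in> H1}"

definition H2_norm :: "(real \<Rightarrow> 'a::euclidean_space) \<Rightarrow> real" where
  "H2_norm u = sqrt ((LINT x|I01. (norm (u x))\<^sup>2) + (LINT x|I01. (norm (wderiv u x))\<^sup>2)
     + (LINT x|I01. (norm (wderiv (wderiv u) x))\<^sup>2))"

text \<open>Pointwise values of \<open>H\<^sup>1\<close> functions on \<open>[0,1]\<close> are those of the continuous representative.\<close>

definition cont_rep :: "(real \<Rightarrow> 'a::euclidean_space) \<Rightarrow> real \<Rightarrow> 'a" where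
  "cont_rep u = (SOME v. continuous_on {0..1} v \<and> (AE x in I01. v x = u x))"

definition H2_0 :: "(real \<Rightarrow> 'a::euclidean_space) set" where
  "H2_0 = {w \<in> H2. cont_rep w 0 = 0 \<and> cont_rep (wderiv w) 0 = 0 \<and> cont_rep (wderiv w) 1 = 0}"

definition H2_closure :: "(real \<Rightarrow> 'a::euclidean_space) set \<Rightarrow> (real \<Rightarrow> 'a) set" where
  "H2_closure S = {w \<in> H2. \<forall>e>0. \<exists>v\<in>S. H2_norm (\<lambda>x. w x - v x) < e}"


section \<open>The set B and the functional J\<close>

definition cutoff :: "(real \<Rightarrow> real) \<Rightarrow> bool" where
  "cutoff c \<longleftrightarrow>
     (\<exists>c' c''. (\<forall>x\<in>{0..1}. (c has_real_derivative c' x) (at x within {0..1})) \<and>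
        (\<forall>x\<in>{0..1}. (c' has_real_derivative c'' x) (at x within {0..1})) \<and>
        continuous_on {0..1} c'') \<and>
     (\<forall>x\<in>{0..1/2}. c x = 1) \<and> (\<forall>x\<in>{3/4..1}. c x = 0) \<and>
     (\<forall>x\<in>{1/2<..<3/4}. 0 < c x \<and> c x < 1)"

definition bdry_ext :: "(real \<Rightarrow> real) \<Rightarrow> 'a::euclidean_space \<Rightarrow> 'a \<Rightarrow> real \<Rightarrow> 'a" where
  "bdry_ext c f0 f1 x = c x *\<^sub>R (f0 + x *\<^sub>R f1)"

definition B_set :: "(real \<Rightarrow> real) \<Rightarrow> real \<Rightarrow> 'a::euclidean_space \<Rightarrow> 'a \<Rightarrow> (real \<Rightarrow> 'a) set" where
  "B_set c R f0 f1 = {W \<in> H2. cont_rep W 0 = f0 \<and> cont_rep (wderiv W) 0 = f1 \<and>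
     cont_rep (wderiv W) 1 = 0 \<and> H2_norm (\<lambda>x. W x - bdry_ext c f0 f1 x) < R}"

definition J_fun :: "real \<Rightarrow> real \<Rightarrow> real \<Rightarrow> real \<Rightarrow> (real \<Rightarrow> complex ^ 'n::{finite,linorder}) \<Rightarrow> real" where
  "J_fun klo khi lam a y =
     exp (2 * lam) * (LINT x|I01. (norm (wderiv (wderiv y) x + F_map klo khi (wderiv y x)))\<^sup>2
                         * exp (- 2 * lam * x))
     + a * (H2_norm y)\<^sup>2"


section \<open>Frechet derivatives with respect to increments in the subspace\<close>

definition has_frechet_H2_0 ::
    "((real \<Rightarrow> 'a::euclidean_space) \<Rightarrow> real) \<Rightarrow> (real \<Rightarrow> 'a) \<Rightarrow> ((real \<Rightarrow> 'a) \<Rightarrow> real) \<Rightarrow> bool" where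
  "has_frechet_H2_0 J y D \<longleftrightarrow>
     (\<forall>g\<in>H2_0. \<forall>h\<in>H2_0. D (\<lambda>x. g x + h x) = D g + D h) \<and>
     (\<forall>c. \<forall>h\<in>H2_0. D (\<lambda>x. c *\<^sub>R h x) = c * D h) \<and>
     (\<exists>K. \<forall>h\<in>H2_0. \<bar>D h\<bar> \<le> K * H2_norm h) \<and>
     (\<forall>e>0. \<exists>d>0. \<forall>h\<in>H2_0. H2_norm h < d \<longrightarrow>
        \<bar>J (\<lambda>x. y x + h x) - J y - D h\<bar> \<le> e * H2_norm h)"

text \<open>The values on \<open>H2_0\<close> of a derivative are unique; the choice below is arbitrary elsewhere.\<close>

definition frechet_H2_0 ::
    "((real \<Rightarrow> 'a::euclidean_space) \<Rightarrow> real) \<Rightarrow> (real \<Rightarrow> 'a) \<Rightarrow> (real \<Rightarrow> 'a) \<Rightarrow> real" where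
  "frechet_H2_0 J y = (SOME D. has_frechet_H2_0 J y D)"

end

theory Submission
  imports Defs
begin

text \<open>
  Let \<open>h\<close> be the difference of the two functions and \<open>A = y'' + F(y')\<close>. The map \<open>F\<close> is a sum of a
  quadratic and a linear map, so that the increment of \<open>y'' + F(y')\<close> is exactly \<open>P = h'' + dF(y') h' + Q(h')\<close>
  with \<open>Q\<close> homogeneous of degree two. Expanding the square, the part of \<open>J(y + h) - J(y)\<close> that is linear
  in \<open>h\<close> is the Frechet derivative, and what remains is exactly
  \<open>exp(2 lam) * \<integral> (|P|\<^sup>2 + 2 A \<bullet> Q(h')) exp(-2 lam x) dx + a * \<parallel>h\<parallel>\<^sup>2\<close>.
  Since \<open>H\<^sup>2\<close> embeds into \<open>C\<^sup>1\<close>, the first derivatives are bounded, and this remainder is of second order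
  in the norm of \<open>h\<close>; this gives differentiability at every point of \<open>H\<^sup>2\<close>
  (lemmas \<open>functional_expand\<close>, \<open>remainder_upper\<close> and \<open>frechet_functional\<close>).

  For convexity the remainder must be bounded from below. Its integrand is at least
  \<open>|h''|\<^sup>2 / 2 - E |h'|\<^sup>2\<close>, times the weight, where \<open>E\<close> is affine in \<open>|y''|\<close>, hence integrable but unbounded.
  The conditions at \<open>x = 0\<close> give \<open>h'\<close> as the integral of \<open>h''\<close> from \<open>0\<close>, and the Cauchy-Schwarz inequality
  then shows that \<open>|h'(x)|\<^sup>2 exp(-2 lam x)\<close> is at most \<open>W / (2 lam)\<close> for every \<open>x\<close>, with
  \<open>W = \<integral> |h''|\<^sup>2 exp(-2 lam x) dx\<close> (lemma \<open>carleman_pointwise\<close>). Such a uniform bound can be multiplied by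
  an integrable function, so the negative part is at most \<open>W / 4\<close> for large \<open>lam\<close>, and \<open>W / 4\<close> is left.
  Because \<open>exp(2 lam) W\<close> dominates \<open>\<integral> |h''|\<^sup>2 dx\<close>, which in turn controls a third of \<open>\<parallel>h\<parallel>\<^sup>2\<close> by the boundary
  conditions, the functional is strictly convex with the constant \<open>1 / 12\<close>. The threshold for \<open>lam\<close>
  depends on \<open>F\<close> and on a bound for the norms of the two functions, through which the radius of the
  ball and the boundary data enter.

  The rest is the theory of Sobolev functions on an interval: a function with a square-integrable weak
  derivative is almost everywhere a constant plus the primitive of that derivative
  (lemma \<open>weak_deriv_primitive\<close>). Uniqueness of weak derivatives, continuity of the traces and the
  embedding into continuous functions follow. It is obtained by testing against trapezoids whose
  flanks shrink to two Lebesgue points.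
\<close>

section \<open>Square-integrable functions on the unit interval\<close>

lemma finite_measure_I01: "finite_measure I01"
  by (rule finite_measure_lebesgue_on) auto

interpretation I01: finite_measure I01
  by (rule finite_measure_I01)

lemma measure_I01 [simp]: "measure I01 {0<..<1} = 1"
  by (simp add: measure_restrict_space)

lemma continuous_imp_measurable_I01:
  fixes f :: "real \<Rightarrow> 'a::euclidean_space"
  assumes "continuous_on {0..1} f"
  shows "f \<in> borel_measurable I01"
  by (rule continuous_imp_measurable_on_sets_lebesgue)
     (auto intro: continuous_on_subset[OF assms])

lemma indicator_measurable_I01:
  "S \<in> sets borel \<Longrightarrow> indicat_real S \<in> borel_measurable I01"
  by (intro measurable_restrict_space1 measurable_completion) auto

lemma L2_measurable [measurable_dest]: "u \<in> L2 \<Longrightarrow> u \<in> borel_measurable I01"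
  by (simp add: L2_def)

lemma L2_square_integrable: "u \<in> L2 \<Longrightarrow> integrable I01 (\<lambda>x. (norm (u x))\<^sup>2)"
  by (simp add: L2_def)

lemma integrable_I01_bounded:
  fixes f :: "real \<Rightarrow> 'a::euclidean_space"
  assumes "integrable I01 f" "g \<in> borel_measurable I01" "AE x in I01. \<bar>g x\<bar> \<le> (K::real)"
  shows "integrable I01 (\<lambda>x. g x *\<^sub>R f x)"
proof (rule Bochner_Integration.integrable_bound)
  show "integrable I01 (\<lambda>x. K * norm (f x))" using assms(1) by auto
  show "(\<lambda>x. g x *\<^sub>R f x) \<in> borel_measurable I01" using assms(1,2) by measurable
  show "AE x in I01. norm (g x *\<^sub>R f x) \<le> norm (K * norm (f x))"
    using assms(3)
  proof eventually_elim
    case (elim x)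
    then show ?case using mult_right_mono[OF elim norm_ge_zero[of "f x"]] by (simp add: abs_mult)
  qed
qed

lemma integrable_I01_bounded_real:
  fixes f :: "real \<Rightarrow> real"
  assumes "integrable I01 f" "g \<in> borel_measurable I01" "AE x in I01. \<bar>g x\<bar> \<le> (K::real)"
  shows "integrable I01 (\<lambda>x. f x * g x)"
  using integrable_I01_bounded[OF assms] by (simp add: mult.commute)

lemma L2_norm_mult_integrable:
  fixes u :: "real \<Rightarrow> 'a::euclidean_space" and v :: "real \<Rightarrow> 'b::euclidean_space"
  assumes "u \<in> L2" "v \<in> L2"
  shows "integrable I01 (\<lambda>x. norm (u x) * norm (v x))"
proof (rule Bochner_Integration.integrable_bound)
  show "integrable I01 (\<lambda>x. (norm (u x))\<^sup>2 + (norm (v x))\<^sup>2)"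
    using assms by (auto simp: L2_def)
  show "(\<lambda>x. norm (u x) * norm (v x)) \<in> borel_measurable I01" using assms by (auto simp: L2_def)
  have "norm (u x) * norm (v x) \<le> (norm (u x))\<^sup>2 + (norm (v x))\<^sup>2" for x
    using sum_squares_bound[of "norm (u x)" "norm (v x)"]
      mult_nonneg_nonneg[OF norm_ge_zero norm_ge_zero, of "u x" "v x"]
    unfolding mult.assoc by linarith
  then show "AE x in I01. norm (norm (u x) * norm (v x)) \<le> norm ((norm (u x))\<^sup>2 + (norm (v x))\<^sup>2)"
    by simp
qed

lemma L2_inner_integrable:
  fixes u v :: "real \<Rightarrow> 'a::euclidean_space"
  assumes "u \<in> L2" "v \<in> L2"
  shows "integrable I01 (\<lambda>x. u x \<bullet> v x)"
  by (rule Bochner_Integration.integrable_bound[OF L2_norm_mult_integrable[OF assms]])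
     (use assms in \<open>auto simp: L2_def Cauchy_Schwarz_ineq2\<close>)

lemma L2_bound:
  fixes u :: "real \<Rightarrow> 'a::euclidean_space" and v :: "real \<Rightarrow> 'b::euclidean_space"
  assumes "v \<in> L2" "u \<in> borel_measurable I01" "AE x in I01. norm (u x) \<le> K * norm (v x)"
  shows "u \<in> L2"
proof -
  have "integrable I01 (\<lambda>x. (norm (u x))\<^sup>2)"
  proof (rule Bochner_Integration.integrable_bound)
    show "integrable I01 (\<lambda>x. K\<^sup>2 * (norm (v x))\<^sup>2)"
      using assms by (auto simp: L2_def)
    show "(\<lambda>x. (norm (u x))\<^sup>2) \<in> borel_measurable I01" using assms by auto
    show "AE x in I01. norm ((norm (u x))\<^sup>2) \<le> norm (K\<^sup>2 * (norm (v x))\<^sup>2)"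
      using assms(3)
    proof eventually_elim
      case (elim x)
      show ?case using power_mono[OF elim norm_ge_zero, of 2] by (simp add: power_mult_distrib)
    qed
  qed
  with assms show ?thesis by (simp add: L2_def)
qed

lemma L2_const: "(\<lambda>x. c) \<in> L2"
  by (simp add: L2_def)

lemma L2_bounded:
  fixes u :: "real \<Rightarrow> 'a::euclidean_space"
  assumes "u \<in> borel_measurable I01" "AE x in I01. norm (u x) \<le> K"
  shows "u \<in> L2"
  by (rule L2_bound[where v = "\<lambda>_. 1::real" and K = K]) (use assms in \<open>auto simp: L2_const\<close>)

lemma L2_continuous:
  fixes u :: "real \<Rightarrow> 'a::euclidean_space"
  assumes "continuous_on {0..1} u"
  shows "u \<in> L2"
proof -
  have "bounded (u ` {0..1})"
    using assms by (intro compact_imp_bounded compact_continuous_image) auto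
  then obtain K where "\<forall>x\<in>{0..1}. norm (u x) \<le> K" by (auto simp: bounded_iff)
  then show ?thesis
    by (intro L2_bounded[of _ K] continuous_imp_measurable_I01 assms) auto
qed

lemma L2_norm: "u \<in> L2 \<Longrightarrow> (\<lambda>x. norm (u x)) \<in> L2"
  by (auto simp: L2_def)

lemma L2_scaleR: "u \<in> L2 \<Longrightarrow> (\<lambda>x. c *\<^sub>R u x) \<in> L2"
  by (rule L2_bound[where v = u and K = "\<bar>c\<bar>"]) auto

lemma L2_add:
  assumes "u \<in> L2" "v \<in> L2"
  shows "(\<lambda>x. u x + v x) \<in> L2"
proof -
  have "(\<lambda>x. norm (u x + v x)) \<in> borel_measurable I01" using assms by measurable
  moreover have "integrable I01 (\<lambda>x. (norm (u x + v x))\<^sup>2)"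
  proof (rule Bochner_Integration.integrable_bound)
    show "integrable I01 (\<lambda>x. 2 * (norm (u x))\<^sup>2 + 2 * (norm (v x))\<^sup>2)"
      using assms by (auto simp: L2_def)
    show "(\<lambda>x. (norm (u x + v x))\<^sup>2) \<in> borel_measurable I01" using assms by measurable
    have "(norm (u x + v x))\<^sup>2 \<le> 2 * (norm (u x))\<^sup>2 + 2 * (norm (v x))\<^sup>2" for x
      using power_mono[OF norm_triangle_ineq[of "u x" "v x"] norm_ge_zero, of 2]
        sum_squares_bound[of "norm (u x)" "norm (v x)"] by (simp add: power2_sum)
    then show "AE x in I01. norm ((norm (u x + v x))\<^sup>2) \<le> norm (2 * (norm (u x))\<^sup>2 + 2 * (norm (v x))\<^sup>2)"
      by simp
  qed
  ultimately show ?thesis using assms by (auto simp: L2_def)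
qed

lemma L2_integrable:
  fixes u :: "real \<Rightarrow> 'a::euclidean_space"
  assumes "u \<in> L2"
  shows "integrable I01 u"
  by (rule Bochner_Integration.integrable_bound[OF L2_norm_mult_integrable[OF assms L2_const[of "1::real"]]])
     (use assms in \<open>auto simp: L2_def\<close>)

text \<open>
  The quadratic polynomial \<open>A - 2 t B + t\<^sup>2 C\<close> in \<open>t\<close>, the integral of \<open>(f - t g)\<^sup>2\<close>, is nonnegative.
\<close>

lemma Cauchy_Schwarz_I01:
  fixes f g :: "real \<Rightarrow> real"
  assumes "f \<in> L2" "g \<in> L2"
  shows "(LINT x|I01. f x * g x)\<^sup>2 \<le> (LINT x|I01. (f x)\<^sup>2) * (LINT x|I01. (g x)\<^sup>2)"
proof -
  define A B C where "A = (LINT x|I01. (f x)\<^sup>2)" and "B = (LINT x|I01. f x * g x)"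
    and "C = (LINT x|I01. (g x)\<^sup>2)"
  have i: "integrable I01 (\<lambda>x. (f x)\<^sup>2)" "integrable I01 (\<lambda>x. (g x)\<^sup>2)"
    "integrable I01 (\<lambda>x. f x * g x)"
    using assms L2_inner_integrable[OF assms] by (auto simp: L2_def)
  have q: "0 \<le> A - 2 * t * B + t\<^sup>2 * C" for t
  proof -
    have "0 \<le> (LINT x|I01. (f x - t * g x)\<^sup>2)" by simp
    also have "\<dots> = (LINT x|I01. (f x)\<^sup>2 - 2 * t * (f x * g x) + t\<^sup>2 * (g x)\<^sup>2)"
      by (intro Bochner_Integration.integral_cong refl) (simp add: power2_eq_square algebra_simps)
    also have "\<dots> = A - 2 * t * B + t\<^sup>2 * C"
      using i by (simp add: A_def B_def C_def)
    finally show ?thesis .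
  qed
  have "C \<ge> 0" by (simp add: C_def)
  show ?thesis unfolding A_def[symmetric] B_def[symmetric] C_def[symmetric]
  proof (cases "C = 0")
    case True
    have "B = 0"
    proof (rule ccontr)
      assume "B \<noteq> 0"
      then show False using q[of "(A + 1) / (2 * B)"] True by (simp add: field_simps)
    qed
    then show "B\<^sup>2 \<le> A * C" using True by simp
  next
    case False
    with \<open>C \<ge> 0\<close> have "C > 0" by simp
    have "0 \<le> C * (A - 2 * (B / C) * B + (B / C)\<^sup>2 * C)" using q[of "B / C"] \<open>C > 0\<close> by simp
    also have "\<dots> = A * C - B\<^sup>2" using \<open>C > 0\<close> by (simp add: power2_eq_square field_simps)
    finally show "B\<^sup>2 \<le> A * C" by simp
  qed
qed

text \<open>Jensen's inequality for the square on a probability space.\<close>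

lemma square_integral_norm_le:
  assumes "u \<in> L2"
  shows "(LINT x|I01. norm (u x))\<^sup>2 \<le> (LINT x|I01. (norm (u x))\<^sup>2)"
  using Cauchy_Schwarz_I01[OF L2_norm[OF assms] L2_const[of "1::real"]] by simp


section \<open>Weak derivatives and primitives\<close>

text \<open>
  Weak derivatives are tested against \<open>C\<^sup>1\<close> functions, and explicit ones suffice. Here \<open>step d\<close> is
  the Heaviside function with its jump spread over \<open>[0, d]\<close>, and \<open>ramp d\<close> is its primitive, which is
  \<open>C\<^sup>1\<close> and tends to the positive part as \<open>d\<close> tends to \<open>0\<close>.
\<close>

definition step :: "real \<Rightarrow> real \<Rightarrow> real" where
  "step d x = (max 0 x - max 0 (x - d)) / d"

definition ramp :: "real \<Rightarrow> real \<Rightarrow> real" where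
  "ramp d x = ((max 0 x)\<^sup>2 - (max 0 (x - d))\<^sup>2) / (2 * d)"

lemma DERIV_positive_part_square:
  "((\<lambda>x::real. (max 0 x)\<^sup>2) has_real_derivative 2 * max 0 x) (at x)"
proof -
  consider "x > 0" | "x < 0" | "x = 0" by linarith
  then show ?thesis
  proof cases
    case 1
    have "((\<lambda>x::real. x\<^sup>2) has_real_derivative 2 * x) (at x)"
      by (auto intro!: derivative_eq_intros)
    then show ?thesis using 1
      by (rule_tac has_field_derivative_transform_within_open[where S = "{0<..}" and f = "\<lambda>x. x\<^sup>2"]) auto
  next
    case 2
    then show ?thesis
      by (rule_tac has_field_derivative_transform_within_open[where S = "{..<0}" and f = "\<lambda>x. 0"]) auto
  next
    case 3
    have "((\<lambda>h::real. (max 0 h)\<^sup>2 / h) \<longlongrightarrow> 0) (at 0)"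
    proof (rule Lim_null_comparison[where g = "\<lambda>h. \<bar>h\<bar>"])
      have "norm ((max 0 h)\<^sup>2 / h) \<le> \<bar>h\<bar>" for h :: real
        by (cases "h > 0") (auto simp: power2_eq_square max_def)
      then show "\<forall>\<^sub>F h in at (0::real). norm ((max 0 h)\<^sup>2 / h) \<le> \<bar>h\<bar>" by simp
      show "((\<lambda>h::real. \<bar>h\<bar>) \<longlongrightarrow> 0) (at 0)" by (simp add: tendsto_rabs_zero)
    qed
    then show ?thesis using 3 by (simp add: DERIV_def)
  qed
qed

lemma DERIV_ramp: "(ramp d has_real_derivative step d x) (at x)"
proof -
  have "((\<lambda>x. (max 0 (x - d))\<^sup>2) has_real_derivative 2 * max 0 (x - d)) (at x)"
    using DERIV_chain2[OF DERIV_positive_part_square DERIV_diff[OF DERIV_ident DERIV_const[of d]]] by simp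
  then have "((\<lambda>x. ((max 0 x)\<^sup>2 - (max 0 (x - d))\<^sup>2) / (2 * d)) has_real_derivative
      (2 * max 0 x - 2 * max 0 (x - d)) / (2 * d)) (at x)"
    by (intro DERIV_cdivide DERIV_diff DERIV_positive_part_square)
  moreover have "(2 * max 0 x - 2 * max 0 (x - d)) / (2 * d) = step d x"
    unfolding step_def right_diff_distrib[symmetric] by (simp only: mult_divide_mult_cancel_left_if) simp
  ultimately show ?thesis by (simp add: ramp_def[abs_def])
qed

lemma continuous_step: "continuous_on S (step d)"
  unfolding step_def divide_inverse by (intro continuous_intros)

lemma step_bounds: "d > 0 \<Longrightarrow> 0 \<le> step d x" "d > 0 \<Longrightarrow> step d x \<le> 1"
  by (auto simp: step_def max_def field_simps)

lemma ramp_bounds: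
  assumes "d > 0"
  shows "0 \<le> ramp d x" "ramp d x \<le> \<bar>x\<bar>"
proof -
  have *: "ramp d x = step d x * ((max 0 x + max 0 (x - d)) / 2)"
    by (simp add: ramp_def step_def power2_eq_square algebra_simps)
  show "0 \<le> ramp d x" unfolding * using step_bounds[OF assms] by simp
  have "step d x * ((max 0 x + max 0 (x - d)) / 2) \<le> 1 * \<bar>x\<bar>"
    using step_bounds[OF assms, of x] assms by (intro mult_mono) auto
  then show "ramp d x \<le> \<bar>x\<bar>" unfolding * by simp
qed

lemma ramp_neg: "x \<le> 0 \<Longrightarrow> d > 0 \<Longrightarrow> ramp d x = 0"
  and ramp_pos: "x \<ge> d \<Longrightarrow> d > 0 \<Longrightarrow> ramp d x = x - d / 2"
  by (auto simp: ramp_def max_def power2_eq_square field_simps)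

lemma step_tendsto:
  assumes "\<And>n. \<delta> n > 0" "\<delta> \<longlonglongrightarrow> 0"
  shows "(\<lambda>n. step (\<delta> n) x) \<longlonglongrightarrow> indicat_real {0<..} x"
proof (cases "x > 0")
  case True
  have "\<forall>\<^sub>F n in sequentially. \<delta> n < x" using assms(2) True by (rule order_tendstoD)
  then have "\<forall>\<^sub>F n in sequentially. step (\<delta> n) x = 1"
    by eventually_elim (use True assms(1) in \<open>auto simp: step_def less_imp_neq[symmetric]\<close>)
  then show ?thesis using True by (simp add: tendsto_eventually)
next
  case False
  then have "step (\<delta> n) x = 0" for n using assms(1)[of n] by (auto simp: step_def max_def)
  then show ?thesis using False by simp
qed

lemma ramp_tendsto:
  assumes "\<And>n. \<delta> n > 0" "\<delta> \<longlonglongrightarrow> 0"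
  shows "(\<lambda>n. ramp (\<delta> n) x) \<longlonglongrightarrow> max 0 x"
proof (cases "x > 0")
  case True
  have "\<forall>\<^sub>F n in sequentially. \<delta> n < x" using assms(2) True by (rule order_tendstoD)
  then have *: "\<forall>\<^sub>F n in sequentially. x - \<delta> n / 2 = ramp (\<delta> n) x"
    by eventually_elim (use assms(1) in \<open>auto simp: ramp_pos less_imp_le\<close>)
  have "(\<lambda>n. x - \<delta> n / 2) \<longlonglongrightarrow> x - 0 / 2" by (intro tendsto_intros assms) auto
  then show ?thesis using True Lim_transform_eventually[OF _ *] by simp
next
  case False
  then show ?thesis using assms(1) by (simp add: ramp_neg)
qed

text \<open>
  For small \<open>h\<close> and away from the corners the four ramps form a trapezoid: it rises on \<open>[a, a + h]\<close>, is constant, and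
  falls on \<open>[b, b + h]\<close>. The rounding of the last corner extends the support by \<open>d\<close>.
\<close>

lemma test_fun_ramps:
  assumes "0 < d" "0 < h" "0 < a" "a \<le> b" "b + h + d < 1"
  defines "p \<equiv> \<lambda>x. ramp d (x - a) - ramp d (x - a - h) - ramp d (x - b) + ramp d (x - b - h)"
  shows "test_fun p"
    and "deriv p = (\<lambda>x. step d (x - a) - step d (x - a - h) - step d (x - b) + step d (x - b - h))"
proof -
  have r: "((\<lambda>x. ramp d (x - c)) has_real_derivative step d (x - c)) (at x)" for x c
    using DERIV_chain2[OF DERIV_ramp DERIV_diff[OF DERIV_ident DERIV_const[of c]]] by simp
  have r2: "((\<lambda>x. ramp d (x - c - e)) has_real_derivative step d (x - c - e)) (at x)" for x c e
    using r[of "c + e" x] by (simp add: diff_diff_eq)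
  have D: "(p has_real_derivative
      step d (x - a) - step d (x - a - h) - step d (x - b) + step d (x - b - h)) (at x)" for x
    unfolding p_def by (intro DERIV_add DERIV_diff r r2)
  show d: "deriv p = (\<lambda>x. step d (x - a) - step d (x - a - h) - step d (x - b) + step d (x - b - h))"
    using D by (auto intro!: DERIV_imp_deriv)
  have "continuous_on UNIV (deriv p)"
    unfolding d
    by (intro continuous_intros continuous_on_compose2[OF continuous_step[of UNIV d]]) auto
  moreover have "p x = 0" if "x \<notin> {a..b + h + d}" for x
  proof -
    consider "x < a" | "x > b + h + d" using \<open>x \<notin> {a..b + h + d}\<close> by force
    then show ?thesis
      by cases (use assms in \<open>auto simp: ramp_neg ramp_pos\<close>)
  qed
  ultimately show "test_fun p"
    unfolding test_fun_def
    using D assms by (meson differentiableI real_differentiable_def)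
qed

text \<open>
  The weak derivative may be tested against piecewise linear trapezoids with flanks of width \<open>h\<close>
  at \<open>a\<close> and \<open>b\<close>: they are the limits of the smooth test functions above as their corners
  sharpen, and dominated convergence applies because the slopes stay bounded.
\<close>

lemma weak_deriv_trapezoid:
  fixes u v :: "real \<Rightarrow> 'a::euclidean_space"
  assumes u: "u \<in> L2" and v: "v \<in> L2" and w: "has_weak_deriv u v"
    and ab: "0 < h" "0 < a" "a \<le> b" "b + h < 1"
  shows "(LINT x|I01. (indicat_real {a<..a + h} x - indicat_real {b<..b + h} x) *\<^sub>R u x)
       = - (LINT x|I01. (h * (step h (x - a) - step h (x - b))) *\<^sub>R v x)"
proof -
  \<comment> \<open>Half of the distance from \<open>b + h\<close> to \<open>1\<close> keeps the supports inside the interval for every \<open>n\<close>.\<close>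
  define \<delta> where "\<delta> n = (1 - b - h) / 2 * inverse (real (Suc n))" for n
  have \<delta>: "\<delta> n > 0" "b + h + \<delta> n < 1" for n
  proof -
    have i: "0 < inverse (real (Suc n))" "inverse (real (Suc n)) \<le> 1"
      by (auto intro: inverse_le_1_iff[THEN iffD2])
    show "\<delta> n > 0" using ab i unfolding \<delta>_def by (intro mult_pos_pos) auto
    have "\<delta> n \<le> (1 - b - h) / 2 * 1" using ab i unfolding \<delta>_def by (intro mult_left_mono) auto
    then show "b + h + \<delta> n < 1" using ab by (simp add: field_simps)
  qed
  have \<delta>0: "\<delta> \<longlonglongrightarrow> 0"
    unfolding \<delta>_def by (rule tendsto_mult_right_zero[OF LIMSEQ_inverse_real_of_nat])
  define p where "p n = (\<lambda>x. ramp (\<delta> n) (x - a) - ramp (\<delta> n) (x - a - h) - ramp (\<delta> n) (x - b)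
      + ramp (\<delta> n) (x - b - h))" for n
  define q where "q n = (\<lambda>x. step (\<delta> n) (x - a) - step (\<delta> n) (x - a - h) - step (\<delta> n) (x - b)
      + step (\<delta> n) (x - b - h))" for n
  have eq: "(LINT x|I01. q n x *\<^sub>R u x) = - (LINT x|I01. p n x *\<^sub>R v x)" for n
  proof -
    have t: "test_fun (p n)" and d: "deriv (p n) = q n"
      unfolding p_def q_def using \<delta>[of n] ab by (intro test_fun_ramps; simp)+
    show ?thesis using w[unfolded has_weak_deriv_def, rule_format, OF t] unfolding d .
  qed
  have cq: "continuous_on UNIV (q n)" for n
    unfolding q_def
    by (intro continuous_intros continuous_on_compose2[OF continuous_step[of UNIV]]) auto
  have cr: "continuous_on UNIV (ramp (\<delta> n))" for n
    using DERIV_ramp DERIV_isCont by (blast intro: continuous_at_imp_continuous_on)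
  have cp: "continuous_on UNIV (p n)" for n
    unfolding p_def by (intro continuous_intros continuous_on_compose2[OF cr]) auto
  have mq: "q n \<in> borel_measurable I01" and mp: "p n \<in> borel_measurable I01" for n
    using cq cp by (auto intro!: continuous_imp_measurable_I01 intro: continuous_on_subset)
  have lq: "(\<lambda>n. q n x) \<longlonglongrightarrow> indicat_real {a<..a + h} x - indicat_real {b<..b + h} x" for x
  proof -
    have "(\<lambda>n. q n x) \<longlonglongrightarrow> indicat_real {0<..} (x - a) - indicat_real {0<..} (x - a - h)
        - indicat_real {0<..} (x - b) + indicat_real {0<..} (x - b - h)"
      unfolding q_def by (intro tendsto_intros step_tendsto \<delta> \<delta>0)
    moreover have "indicat_real {0<..} (x - a) - indicat_real {0<..} (x - a - h)
        - indicat_real {0<..} (x - b) + indicat_real {0<..} (x - b - h)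
        = indicat_real {a<..a + h} x - indicat_real {b<..b + h} x"
      using ab by (auto simp: indicator_def)
    ultimately show ?thesis by simp
  qed
  have lp: "(\<lambda>n. p n x) \<longlonglongrightarrow> h * (step h (x - a) - step h (x - b))" for x
  proof -
    have "(\<lambda>n. p n x) \<longlonglongrightarrow> max 0 (x - a) - max 0 (x - a - h) - max 0 (x - b) + max 0 (x - b - h)"
      unfolding p_def by (intro tendsto_intros ramp_tendsto \<delta> \<delta>0)
    moreover have "max 0 (x - a) - max 0 (x - a - h) - max 0 (x - b) + max 0 (x - b - h)
        = h * (step h (x - a) - step h (x - b))"
      using ab by (simp add: step_def field_simps)
    ultimately show ?thesis by simp
  qed
  have bq: "\<bar>q n x\<bar> \<le> 4" for n x
    using step_bounds[OF \<delta>(1)[of n], of "x - a"] step_bounds[OF \<delta>(1)[of n], of "x - a - h"]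
      step_bounds[OF \<delta>(1)[of n], of "x - b"] step_bounds[OF \<delta>(1)[of n], of "x - b - h"]
    unfolding q_def by linarith
  have bp: "\<bar>p n x\<bar> \<le> 8" if "x \<in> {0<..<1}" for n x
    using ramp_bounds[OF \<delta>(1)[of n], of "x - a"] ramp_bounds[OF \<delta>(1)[of n], of "x - a - h"]
      ramp_bounds[OF \<delta>(1)[of n], of "x - b"] ramp_bounds[OF \<delta>(1)[of n], of "x - b - h"] that ab
    unfolding p_def greaterThanLessThan_iff by linarith
  have iu: "integrable I01 (\<lambda>x. norm (u x))" and iv: "integrable I01 (\<lambda>x. norm (v x))"
    using u v by (auto intro: L2_integrable)
  have ms: "(\<lambda>x. h * (step h (x - a) - step h (x - b))) \<in> borel_measurable I01"
    by (intro continuous_imp_measurable_I01 continuous_intros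
        continuous_on_compose2[OF continuous_step[of UNIV]]) auto
  have L: "(\<lambda>n. LINT x|I01. q n x *\<^sub>R u x) \<longlonglongrightarrow>
      (LINT x|I01. (indicat_real {a<..a + h} x - indicat_real {b<..b + h} x) *\<^sub>R u x)"
  proof (rule integral_dominated_convergence[where w = "\<lambda>x. 4 * norm (u x)"])
    show "(\<lambda>x. (indicat_real {a<..a + h} x - indicat_real {b<..b + h} x) *\<^sub>R u x) \<in> borel_measurable I01"
      using u by (intro borel_measurable_scaleR borel_measurable_diff indicator_measurable_I01) (auto simp: L2_def)
    show "(\<lambda>x. q n x *\<^sub>R u x) \<in> borel_measurable I01" for n
      using mq[of n] u by measurable
    show "AE x in I01. (\<lambda>n. q n x *\<^sub>R u x) \<longlonglongrightarrow>
        (indicat_real {a<..a + h} x - indicat_real {b<..b + h} x) *\<^sub>R u x"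
      by (intro AE_I2 tendsto_scaleR lq tendsto_const)
    show "AE x in I01. norm (q n x *\<^sub>R u x) \<le> 4 * norm (u x)" for n
      using bq by (auto intro!: mult_right_mono)
    show "integrable I01 (\<lambda>x. 4 * norm (u x))" using iu by simp
  qed
  have R: "(\<lambda>n. LINT x|I01. p n x *\<^sub>R v x) \<longlonglongrightarrow>
      (LINT x|I01. (h * (step h (x - a) - step h (x - b))) *\<^sub>R v x)"
  proof (rule integral_dominated_convergence[where w = "\<lambda>x. 8 * norm (v x)"])
    show "(\<lambda>x. (h * (step h (x - a) - step h (x - b))) *\<^sub>R v x) \<in> borel_measurable I01"
      using ms v by measurable
    show "(\<lambda>x. p n x *\<^sub>R v x) \<in> borel_measurable I01" for n
      using mp[of n] v by measurable
    show "AE x in I01. (\<lambda>n. p n x *\<^sub>R v x) \<longlonglongrightarrow> (h * (step h (x - a) - step h (x - b))) *\<^sub>R v x"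
      by (intro AE_I2 tendsto_scaleR lp tendsto_const)
    show "AE x in I01. norm (p n x *\<^sub>R v x) \<le> 8 * norm (v x)" for n
      using bp by (auto intro!: mult_right_mono)
    show "integrable I01 (\<lambda>x. 8 * norm (v x))" using iv by simp
  qed
  show ?thesis
    using LIMSEQ_unique[OF L] tendsto_minus[OF R] unfolding eq by blast
qed

text \<open>
  Only right-hand averages over the intervals of length \<open>1 / (n + 1)\<close> are asked to converge: these
  are the averages that the trapezoids above produce at their two flanks.
\<close>

definition lebesgue_point :: "(real \<Rightarrow> 'a::euclidean_space) \<Rightarrow> real \<Rightarrow> bool" where
  "lebesgue_point u a \<longleftrightarrow>
     (\<lambda>n. real (Suc n) *\<^sub>R (LINT x|I01. indicat_real {a<..a + 1 / real (Suc n)} x *\<^sub>R u x)) \<longlonglongrightarrow> u a"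

lemma AE_I01_iff_negligible:
  "(AE x in I01. P x) \<longleftrightarrow> negligible {x \<in> {0<..<1}. \<not> P x}"
proof -
  have "(AE x in I01. P x) \<longleftrightarrow> (AE x in lebesgue. x \<in> {0<..<1} \<longrightarrow> P x)"
    by (rule AE_restrict_space_iff) auto
  also have "\<dots> \<longleftrightarrow> {x \<in> {0<..<1}. \<not> P x} \<in> null_sets lebesgue"
  proof
    assume "AE x in lebesgue. x \<in> {0<..<1} \<longrightarrow> P x"
    then obtain N where Nn: "N \<in> null_sets lebesgue"
      and N: "{x \<in> space lebesgue. \<not> (x \<in> {0<..<1} \<longrightarrow> P x)} \<subseteq> N"
      unfolding eventually_ae_filter by blast
    have "{x \<in> {0<..<1}. \<not> P x} \<subseteq> N" using N by auto
    then show "{x \<in> {0<..<1}. \<not> P x} \<in> null_sets lebesgue"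
      using Nn by (rule completion.complete2)
  next
    assume "{x \<in> {0<..<1}. \<not> P x} \<in> null_sets lebesgue"
    then show "AE x in lebesgue. x \<in> {0<..<1} \<longrightarrow> P x" by (rule AE_I') auto
  qed
  finally show ?thesis by (simp add: negligible_iff_null_sets)
qed

lemma AE_lebesgue_point:
  fixes u :: "real \<Rightarrow> 'a::euclidean_space"
  assumes "integrable I01 u"
  shows "AE a in I01. lebesgue_point u a"
proof -
  define f where "f x = (if x \<in> {0<..<1} then u x else 0)" for x
  have f: "integrable lebesgue f"
    unfolding f_def using assms by (subst Lebesgue_Measure.integrable_restrict_UNIV) auto
  have fS: "integrable (lebesgue_on S) f" if "S \<in> sets lebesgue" for S
  proof (subst integrable_restrict_space)
    show "integrable lebesgue (\<lambda>x. indicat_real S x *\<^sub>R f x)"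
      using that f by (rule integrable_mult_indicator)
  qed (use that in auto)
  have "f integrable_on cbox a b" for a b
    by (rule integrable_on_lebesgue_on) (auto intro: fS)
  then show ?thesis
  proof (rule integrable_ccontinuous_explicit)
    fix N :: "real set"
    assume N: "negligible N" and
      lim: "\<And>x e. \<lbrakk>x \<notin> N; 0 < e\<rbrakk> \<Longrightarrow> \<exists>d>0. \<forall>h. 0 < h \<and> h < d \<longrightarrow>
       norm (integral (cbox x (x + h *\<^sub>R One)) f /\<^sub>R h ^ DIM(real) - f x) < e"
  have "lebesgue_point u a" if aN: "a \<notin> N" and "a \<in> {0<..<1}" for a
    unfolding lebesgue_point_def
  proof (rule LIMSEQ_I)
    fix e :: real assume "e > 0"
    then obtain d where d: "d > 0"
      "\<And>h. 0 < h \<Longrightarrow> h < d \<Longrightarrow> norm (integral {a..a + h} f /\<^sub>R h - f a) < e"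
      using lim[OF aN, of e] by auto
    obtain n0 where n0: "1 / real (Suc n0) < d" using nat_approx_posE[OF d(1)] by blast
    have "norm (real (Suc n) *\<^sub>R (LINT x|I01. indicat_real {a<..a + 1 / real (Suc n)} x *\<^sub>R u x) - u a) < e"
      if "n \<ge> n0" for n
    proof -
      define h where "h = 1 / real (Suc n)"
      have "h \<le> 1 / real (Suc n0)" unfolding h_def using that by (intro frac_le) auto
      then have h: "h > 0" "h < d" using n0 by (auto simp: h_def)
      have "(LINT x|I01. indicat_real {a<..a + h} x *\<^sub>R u x)
          = (LINT x|lebesgue. indicat_real {0<..<1} x *\<^sub>R (indicat_real {a<..a + h} x *\<^sub>R u x))"
        by (rule integral_restrict_space) auto
      also have "\<dots> = (LINT x|lebesgue. indicat_real {a..a + h} x *\<^sub>R f x)"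
      proof (rule integral_discrete_difference[where X = "{a}"])
        show "emeasure lebesgue {x} = 0" if "x \<in> {a}" for x by simp
      qed (auto simp: f_def indicator_def)
      also have "\<dots> = (LINT x|lebesgue_on {a..a + h}. f x)"
        by (rule integral_restrict_space[symmetric]) auto
      also have "\<dots> = integral {a..a + h} f"
        by (rule lebesgue_integral_eq_integral) (auto intro: fS)
      finally have "norm (real (Suc n) *\<^sub>R (LINT x|I01. indicat_real {a<..a + h} x *\<^sub>R u x) - u a)
          = norm (integral {a..a + h} f /\<^sub>R h - f a)"
        using \<open>a \<in> {0<..<1}\<close> by (simp add: h_def f_def divide_inverse)
      then show ?thesis using d(2)[OF h] by (simp add: h_def)
    qed
    then show "\<exists>n0. \<forall>n\<ge>n0. norm (real (Suc n) *\<^sub>R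
        (LINT x|I01. indicat_real {a<..a + 1 / real (Suc n)} x *\<^sub>R u x) - u a) < e" by blast
  qed
  then show "AE a in I01. lebesgue_point u a"
    unfolding AE_I01_iff_negligible by (intro negligible_subset[OF N]) auto
  qed
qed

text \<open>
  The fundamental theorem of calculus at Lebesgue points. The trapezoid of flank width \<open>h\<close>, divided
  by \<open>h\<close>, has as its derivative the difference of two averaging kernels, so that the left side of
  the defining identity tends to \<open>u a - u b\<close>, while the trapezoid itself tends to the indicator
  function of \<open>(a, b]\<close>.
\<close>

lemma weak_deriv_increment:
  fixes u v :: "real \<Rightarrow> 'a::euclidean_space"
  assumes u: "u \<in> L2" and v: "v \<in> L2" and w: "has_weak_deriv u v"
    and ab: "0 < a" "a \<le> b" "b < 1" and la: "lebesgue_point u a" and lb: "lebesgue_point u b"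
  shows "u b - u a = (LINT x|I01. indicat_real {a<..b} x *\<^sub>R v x)"
proof -
  define h where "h n = 1 / real (Suc n)" for n
  have h: "h n > 0" for n by (simp add: h_def)
  have h0: "h \<longlonglongrightarrow> 0" using LIMSEQ_inverse_real_of_nat by (simp add: h_def[abs_def] inverse_eq_divide)
  have iu: "integrable I01 u" and iv: "integrable I01 (\<lambda>x. norm (v x))"
    using u v by (auto intro: L2_integrable)
  define A where "A c n = real (Suc n) *\<^sub>R (LINT x|I01. indicat_real {c<..c + h n} x *\<^sub>R u x)" for c n
  define V where "V n = (LINT x|I01. (step (h n) (x - a) - step (h n) (x - b)) *\<^sub>R v x)" for n
  have "\<forall>\<^sub>F n in sequentially. h n < 1 - b" using h0 ab by (intro order_tendstoD) auto
  then have eq: "\<forall>\<^sub>F n in sequentially. A a n - A b n = - V n"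
  proof eventually_elim
    case (elim n)
    have ind: "integrable I01 (\<lambda>x. indicat_real {c<..c + h n} x *\<^sub>R u x)" for c
      by (rule integrable_I01_bounded[OF iu indicator_measurable_I01, where K = 1]) auto
    have 0: "(LINT x|I01. (indicat_real {a<..a + h n} x - indicat_real {b<..b + h n} x) *\<^sub>R u x)
        = (LINT x|I01. indicat_real {a<..a + h n} x *\<^sub>R u x) - (LINT x|I01. indicat_real {b<..b + h n} x *\<^sub>R u x)"
      using ind by (simp add: scaleR_diff_left)
    have 2: "(LINT x|I01. (h n * (step (h n) (x - a) - step (h n) (x - b))) *\<^sub>R v x) = h n *\<^sub>R V n"
      unfolding V_def scaleR_scaleR[symmetric] by (rule integral_scaleR_right)
    have 1: "(LINT x|I01. indicat_real {a<..a + h n} x *\<^sub>R u x) - (LINT x|I01. indicat_real {b<..b + h n} x *\<^sub>R u x)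
       = - (h n *\<^sub>R V n)"
      using weak_deriv_trapezoid[OF u v w h[of n] ab(1,2)] elim unfolding 0 2 by simp
    have "A a n - A b n = real (Suc n) *\<^sub>R
        ((LINT x|I01. indicat_real {a<..a + h n} x *\<^sub>R u x) - (LINT x|I01. indicat_real {b<..b + h n} x *\<^sub>R u x))"
      by (simp only: A_def scaleR_diff_right)
    also have "\<dots> = - V n"
      unfolding 1 by (simp add: h_def del: of_nat_Suc)
    finally show ?case .
  qed
  \<comment> \<open>The averages converge because both end points are Lebesgue points.\<close>
  have 1: "(\<lambda>n. A a n - A b n) \<longlonglongrightarrow> u a - u b"
    unfolding A_def h_def by (intro tendsto_diff la[unfolded lebesgue_point_def] lb[unfolded lebesgue_point_def])
  have "V \<longlonglongrightarrow> (LINT x|I01. (indicat_real {0<..} (x - a) - indicat_real {0<..} (x - b)) *\<^sub>R v x)"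
    unfolding V_def
  proof (rule integral_dominated_convergence[where w = "\<lambda>x. norm (v x)"])
    show "(\<lambda>x. (step (h n) (x - a) - step (h n) (x - b)) *\<^sub>R v x) \<in> borel_measurable I01" for n
    proof -
      have "(\<lambda>x. step (h n) (x - a) - step (h n) (x - b)) \<in> borel_measurable I01"
        by (intro continuous_imp_measurable_I01 continuous_intros
            continuous_on_compose2[OF continuous_step[of UNIV]]) auto
      then show ?thesis using v by measurable
    qed
    show "(\<lambda>x. (indicat_real {0<..} (x - a) - indicat_real {0<..} (x - b)) *\<^sub>R v x) \<in> borel_measurable I01"
    proof -
      have "(\<lambda>x. indicat_real {a<..} x - indicat_real {b<..} x) \<in> borel_measurable I01"
        by (intro borel_measurable_diff indicator_measurable_I01) auto
      moreover have "(\<lambda>x. indicat_real {a<..} x - indicat_real {b<..} x) =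
          (\<lambda>x. indicat_real {0<..} (x - a) - indicat_real {0<..} (x - b))"
        by (auto simp: indicator_def)
      ultimately show ?thesis using v by (simp add: borel_measurable_scaleR L2_def)
    qed
    show "AE x in I01. (\<lambda>n. (step (h n) (x - a) - step (h n) (x - b)) *\<^sub>R v x) \<longlonglongrightarrow>
        (indicat_real {0<..} (x - a) - indicat_real {0<..} (x - b)) *\<^sub>R v x"
      by (intro AE_I2 tendsto_intros step_tendsto h h0)
    have "\<bar>step (h n) (x - a) - step (h n) (x - b)\<bar> \<le> 1" for n x
      using step_bounds[OF h[of n], of "x - a"] step_bounds[OF h[of n], of "x - b"] by linarith
    then have "norm ((step (h n) (x - a) - step (h n) (x - b)) *\<^sub>R v x) \<le> 1 * norm (v x)" for n x
      unfolding norm_scaleR by (intro mult_right_mono) auto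
    then show "AE x in I01. norm ((step (h n) (x - a) - step (h n) (x - b)) *\<^sub>R v x) \<le> norm (v x)" for n
      by simp
  qed (rule iv)
  moreover have "(\<lambda>x. indicat_real {0<..} (x - a) - indicat_real {0<..} (x - b)) = indicat_real {a<..b}"
    using ab by (auto simp: indicator_def fun_eq_iff)
  ultimately have "V \<longlonglongrightarrow> (LINT x|I01. indicat_real {a<..b} x *\<^sub>R v x)"
    by (metis (no_types, lifting) Bochner_Integration.integral_cong)
  then have "(\<lambda>n. - V n) \<longlonglongrightarrow> - (LINT x|I01. indicat_real {a<..b} x *\<^sub>R v x)" by (rule tendsto_minus)
  then have "(\<lambda>n. A a n - A b n) \<longlonglongrightarrow> - (LINT x|I01. indicat_real {a<..b} x *\<^sub>R v x)"
    by (rule Lim_transform_eventually) (use eq in \<open>simp add: eventually_mono eq_commute\<close>)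
  with 1 have "u a - u b = - (LINT x|I01. indicat_real {a<..b} x *\<^sub>R v x)" by (rule LIMSEQ_unique)
  then show ?thesis using minus_diff_eq[of "u a" "u b"] by simp
qed

text \<open>
  The primitive that vanishes at \<open>0\<close>. Writing it as one integral over the whole interval, with an
  indicator function, makes it defined for all real arguments and lets convergence theorems for
  functions on \<open>(0, 1)\<close> apply directly.
\<close>

definition prim :: "(real \<Rightarrow> 'a::euclidean_space) \<Rightarrow> real \<Rightarrow> 'a" where
  "prim v x = (LINT t|I01. indicat_real {..x} t *\<^sub>R v t)"

lemma integrable_indicator_I01:
  fixes v :: "real \<Rightarrow> 'a::euclidean_space"
  assumes "integrable I01 v" "S \<in> sets borel"
  shows "integrable I01 (\<lambda>t. indicat_real S t *\<^sub>R v t)"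
  by (rule integrable_I01_bounded[OF assms(1) indicator_measurable_I01[OF assms(2)], where K = 1]) auto

lemma prim_diff:
  assumes "integrable I01 v" "x \<le> y"
  shows "prim v y - prim v x = (LINT t|I01. indicat_real {x<..y} t *\<^sub>R v t)"
proof -
  have "prim v y - prim v x = (LINT t|I01. indicat_real {..y} t *\<^sub>R v t - indicat_real {..x} t *\<^sub>R v t)"
    unfolding prim_def
    by (rule Bochner_Integration.integral_diff[symmetric])
       (auto intro: integrable_indicator_I01[OF assms(1)])
  also have "\<dots> = (LINT t|I01. indicat_real {x<..y} t *\<^sub>R v t)"
    using assms(2) by (intro Bochner_Integration.integral_cong) (auto simp: indicator_def)
  finally show ?thesis .
qed

lemma prim_linear:
  assumes "integrable I01 v" "integrable I01 w"
  shows "prim (\<lambda>x. v x - w x) x = prim v x - prim w x"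
  unfolding prim_def scaleR_diff_right
  by (rule Bochner_Integration.integral_diff) (auto intro: integrable_indicator_I01 assms)

lemma prim_0 [simp]: "prim v 0 = 0"
proof -
  have "prim v 0 = (LINT t|I01. 0)"
    unfolding prim_def by (rule Bochner_Integration.integral_cong) auto
  then show ?thesis by simp
qed

lemma norm_prim_le:
  assumes "integrable I01 v"
  shows "norm (prim v x) \<le> prim (\<lambda>t. norm (v t)) x"
proof -
  have "norm (prim v x) \<le> (LINT t|I01. norm (indicat_real {..x} t *\<^sub>R v t))"
    unfolding prim_def by (rule integral_norm_bound)
  also have "\<dots> = prim (\<lambda>t. norm (v t)) x"
    unfolding prim_def by (rule Bochner_Integration.integral_cong) auto
  finally show ?thesis .
qed

lemma norm_prim_diff_le:
  assumes "integrable I01 v"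
  shows "norm (prim v y - prim v x) \<le> (LINT t|I01. norm (v t))"
proof -
  have *: "norm (prim v b - prim v a) \<le> (LINT t|I01. norm (v t))" if "a \<le> b" for a b
  proof -
    have "norm (prim v b - prim v a) \<le> (LINT t|I01. norm (indicat_real {a<..b} t *\<^sub>R v t))"
      unfolding prim_diff[OF assms that] by (rule integral_norm_bound)
    also have "\<dots> \<le> (LINT t|I01. norm (v t))"
    proof (rule integral_mono)
      show "integrable I01 (\<lambda>t. norm (indicat_real {a<..b} t *\<^sub>R v t))"
        by (intro integrable_norm integrable_indicator_I01 assms) auto
      show "integrable I01 (\<lambda>t. norm (v t))" using assms by (rule integrable_norm)
      show "norm (indicat_real {a<..b} t *\<^sub>R v t) \<le> norm (v t)" for t by (auto simp: indicator_def)
    qed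
    finally show ?thesis .
  qed
  show ?thesis using *[of x y] *[of y x] by (cases "x \<le> y") (auto simp: norm_minus_commute)
qed

lemma AE_I01_neq: "AE t in I01. t \<noteq> x"
  unfolding AE_I01_iff_negligible by (rule negligible_subset[of "{x}"]) auto

lemma continuous_on_prim:
  assumes "integrable I01 v"
  shows "continuous_on S (prim v)"
  unfolding continuous_on_sequentially
proof (intro allI ballI impI)
  fix X x assume "x \<in> S" and X: "(\<forall>n. X n \<in> S) \<and> X \<longlonglongrightarrow> x"
  have "(\<lambda>n. LINT t|I01. indicat_real {..X n} t *\<^sub>R v t) \<longlonglongrightarrow> (LINT t|I01. indicat_real {..x} t *\<^sub>R v t)"
  proof (rule integral_dominated_convergence[where w = "\<lambda>t. norm (v t)"])
    show "AE t in I01. (\<lambda>n. indicat_real {..X n} t *\<^sub>R v t) \<longlonglongrightarrow> indicat_real {..x} t *\<^sub>R v t"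
      using AE_I01_neq[of x]
    proof eventually_elim
      case (elim t)
      have "\<forall>\<^sub>F n in sequentially. indicat_real {..X n} t = indicat_real {..x} t"
      proof (cases "t < x")
        case True
        then have "\<forall>\<^sub>F n in sequentially. t < X n" using X by (intro order_tendstoD) auto
        then show ?thesis by eventually_elim (use True in auto)
      next
        case False
        then have "\<forall>\<^sub>F n in sequentially. X n < t" using X elim by (intro order_tendstoD) auto
        then show ?thesis by eventually_elim (use False elim in auto)
      qed
      then show ?case by (intro tendsto_scaleR tendsto_const tendsto_eventually)
    qed
    show "AE t in I01. norm (indicat_real {..X n} t *\<^sub>R v t) \<le> norm (v t)" for n
      by (auto simp: indicator_def)
  qed (use assms in \<open>auto intro!: borel_measurable_integrable integrable_indicator_I01\<close>)
  then show "(prim v \<circ> X) \<longlonglongrightarrow> prim v x" by (simp add: prim_def o_def)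
qed

lemma AE_I01_ex:
  assumes "AE x in I01. P x"
  shows "\<exists>x\<in>{0<..<1}. P x"
proof (rule ccontr)
  assume "\<not> ?thesis"
  then have "{x \<in> {0<..<1}. \<not> P x} = {0<..<1::real}" by auto
  with assms have "negligible {0<..<1::real}" by (simp add: AE_I01_iff_negligible)
  then show False using open_not_negligible[of "{0<..<1::real}"] by auto
qed

text \<open>
  The representation of \<open>H\<^sup>1\<close> functions on an interval. All that follows about traces and about
  uniqueness of weak derivatives rests on it.
\<close>

lemma weak_deriv_primitive:
  fixes u v :: "real \<Rightarrow> 'a::euclidean_space"
  assumes u: "u \<in> L2" and v: "v \<in> L2" and w: "has_weak_deriv u v"
  shows "\<exists>c. AE x in I01. u x = c + prim v x"
proof -
  have iv: "integrable I01 v" using v by (rule L2_integrable)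
  have ae: "AE x in I01. lebesgue_point u x" by (rule AE_lebesgue_point[OF L2_integrable[OF u]])
  obtain a where a: "a \<in> {0<..<1}" "lebesgue_point u a" using AE_I01_ex[OF ae] by blast
  have pt: "u x = (u a - prim v a) + prim v x" if "x \<in> {0<..<1}" "lebesgue_point u x" for x
  proof (cases "a \<le> x")
    case True
    then show ?thesis
      using weak_deriv_increment[OF u v w, of a x] prim_diff[OF iv, of a x] a that
      by (auto simp: algebra_simps)
  next
    case False
    then show ?thesis
      using weak_deriv_increment[OF u v w, of x a] prim_diff[OF iv, of x a] a that
      by (auto simp: algebra_simps)
  qed
  from ae AE_space[of I01] have "AE x in I01. u x = (u a - prim v a) + prim v x"
    by eventually_elim (use pt in simp)
  then show ?thesis by blast
qed

text \<open>
  The set on which two continuous functions differ is open, hence empty if it is negligible; the end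
  points are reached by continuity.
\<close>

lemma continuous_AE_eq:
  fixes f g :: "real \<Rightarrow> 'a::euclidean_space"
  assumes f: "continuous_on {0..1} f" and g: "continuous_on {0..1} g"
    and ae: "AE x in I01. f x = g x" and x: "x \<in> {0..1}"
  shows "f x = g x"
proof -
  define k where "k x = f x - g x" for x
  have k: "continuous_on {0..1} k" unfolding k_def by (intro continuous_intros f g)
  have "open ({0<..<1} \<inter> k -` (- {0}))"
    by (rule continuous_open_preimage) (auto intro: continuous_on_subset[OF k])
  moreover have "{0<..<1} \<inter> k -` (- {0}) = {x \<in> {0<..<1}. f x \<noteq> g x}"
    by (auto simp: k_def)
  ultimately have "{x \<in> {0<..<1}. f x \<noteq> g x} = {}"
    using ae open_not_negligible unfolding AE_I01_iff_negligible by metis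
  then have z: "k y = 0" if "y \<in> {0<..<1}" for y using that by (auto simp: k_def)
  have "k x = 0"
    by (rule continuous_constant_on_closure[of "{0<..<1}" k]) (use k z x in auto)
  then show ?thesis by (simp add: k_def)
qed

lemma prim_eq_0_imp:
  fixes z :: "real \<Rightarrow> 'a::euclidean_space"
  assumes z: "integrable I01 z" and p: "\<And>x. x \<in> {0..1} \<Longrightarrow> prim z x = 0"
  shows "AE x in I01. z x = 0"
proof -
  have pt: "z a = 0" if a: "a \<in> {0<..<1}" "lebesgue_point z a" for a
  proof -
    define h where "h n = 1 / real (Suc n)" for n
    have "h \<longlonglongrightarrow> 0"
      using LIMSEQ_inverse_real_of_nat by (simp add: h_def[abs_def] inverse_eq_divide)
    then have "\<forall>\<^sub>F n in sequentially. h n < 1 - a" using a by (intro order_tendstoD) auto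
    then have "\<forall>\<^sub>F n in sequentially. real (Suc n) *\<^sub>R (LINT x|I01. indicat_real {a<..a + h n} x *\<^sub>R z x) = 0"
    proof eventually_elim
      case (elim n)
      have "h n > 0" by (simp add: h_def)
      then have "(LINT x|I01. indicat_real {a<..a + h n} x *\<^sub>R z x) = 0"
        using prim_diff[OF z, of a "a + h n"] p[of a] p[of "a + h n"] a elim by auto
      then show ?case by simp
    qed
    then have "(\<lambda>n. real (Suc n) *\<^sub>R (LINT x|I01. indicat_real {a<..a + h n} x *\<^sub>R z x)) \<longlonglongrightarrow> 0"
      by (rule tendsto_eventually)
    then show ?thesis using a(2) unfolding lebesgue_point_def h_def by (rule LIMSEQ_unique[rotated])
  qed
  from AE_lebesgue_point[OF z] AE_space[of I01] show ?thesis
    by eventually_elim (use pt in simp)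
qed

text \<open>
  Two weak derivatives of \<open>u\<close> have continuous primitives that both represent \<open>u\<close>, hence agree
  everywhere; then the averages of the difference vanish, and so does the difference at each of its
  Lebesgue points.
\<close>

lemma weak_deriv_unique:
  fixes u v w :: "real \<Rightarrow> 'a::euclidean_space"
  assumes u: "u \<in> L2" and v: "v \<in> L2" "has_weak_deriv u v" and w: "w \<in> L2" "has_weak_deriv u w"
  shows "AE x in I01. v x = w x"
proof -
  have iv: "integrable I01 v" and iw: "integrable I01 w" using v w by (auto intro: L2_integrable)
  obtain c where c: "AE x in I01. u x = c + prim v x" using weak_deriv_primitive[OF u v] by blast
  obtain d where d: "AE x in I01. u x = d + prim w x" using weak_deriv_primitive[OF u w] by blast
  have ae: "AE x in I01. c + prim v x = d + prim w x" using c d by eventually_elim simp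
  have eq: "c + prim v x = d + prim w x" if "x \<in> {0..1}" for x
    by (rule continuous_AE_eq[OF _ _ ae that])
       (intro continuous_intros continuous_on_prim iv iw)+
  have "c = d" using eq[of 0] by simp
  then have "AE x in I01. v x - w x = 0"
    using eq by (intro prim_eq_0_imp) (auto simp: prim_linear iv iw)
  then show ?thesis by simp
qed

lemma test_fun_continuous:
  assumes "test_fun p"
  shows "continuous_on S p" "continuous_on S (deriv p)"
proof -
  have "\<And>x. isCont p x" using assms by (auto simp: test_fun_def intro: differentiable_imp_continuous_within)
  then show "continuous_on S p" by (simp add: continuous_at_imp_continuous_on)
  have "continuous_on UNIV (deriv p)" using assms by (simp add: test_fun_def)
  then show "continuous_on S (deriv p)" by (rule continuous_on_subset) auto
qed

lemma integrable_continuous_scaleR: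
  fixes u :: "real \<Rightarrow> 'a::euclidean_space" and q :: "real \<Rightarrow> real"
  assumes "continuous_on {0..1} q" "integrable I01 u"
  shows "integrable I01 (\<lambda>x. q x *\<^sub>R u x)"
proof -
  have "bounded (q ` {0..1})"
    using assms by (intro compact_imp_bounded compact_continuous_image) auto
  then obtain K where "\<forall>x\<in>{0..1}. \<bar>q x\<bar> \<le> K" by (auto simp: bounded_iff)
  then show ?thesis
    by (intro integrable_I01_bounded[OF assms(2), where K = K] continuous_imp_measurable_I01 assms) auto
qed

lemma has_weak_deriv_cong:
  assumes "has_weak_deriv u v" "u \<in> L2" "u' \<in> L2" "v \<in> L2" "v' \<in> L2"
    "AE x in I01. u x = u' x" "AE x in I01. v x = v' x"
  shows "has_weak_deriv u' v'"
  unfolding has_weak_deriv_def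
proof (intro allI impI)
  fix p assume p: "test_fun p"
  have m: "p \<in> borel_measurable I01" "deriv p \<in> borel_measurable I01"
    using test_fun_continuous[OF p] by (auto intro: continuous_imp_measurable_I01)
  have "(LINT x|I01. deriv p x *\<^sub>R u' x) = (LINT x|I01. deriv p x *\<^sub>R u x)"
    by (rule integral_cong_AE) (use m assms in \<open>auto simp: L2_def\<close>)
  also have "\<dots> = - (LINT x|I01. p x *\<^sub>R v x)"
    using assms(1) p by (simp add: has_weak_deriv_def)
  also have "(LINT x|I01. p x *\<^sub>R v x) = (LINT x|I01. p x *\<^sub>R v' x)"
    by (rule integral_cong_AE) (use m assms in \<open>auto simp: L2_def\<close>)
  finally show "(LINT x|I01. deriv p x *\<^sub>R u' x) = - (LINT x|I01. p x *\<^sub>R v' x)" .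
qed

lemma has_weak_deriv_add:
  assumes "has_weak_deriv u v" "has_weak_deriv u' v'" "u \<in> L2" "u' \<in> L2" "v \<in> L2" "v' \<in> L2"
  shows "has_weak_deriv (\<lambda>x. u x + u' x) (\<lambda>x. v x + v' x)"
  unfolding has_weak_deriv_def
proof (intro allI impI)
  fix p assume p: "test_fun p"
  have i: "integrable I01 (\<lambda>x. p x *\<^sub>R z x)" "integrable I01 (\<lambda>x. deriv p x *\<^sub>R z x)"
    if "z \<in> L2" for z :: "real \<Rightarrow> 'a"
    using that test_fun_continuous[OF p] by (auto intro: integrable_continuous_scaleR L2_integrable)
  show "(LINT x|I01. deriv p x *\<^sub>R (u x + u' x)) = - (LINT x|I01. p x *\<^sub>R (v x + v' x))"
    using assms p i by (simp add: scaleR_add_right has_weak_deriv_def)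
qed

lemma has_weak_deriv_scaleR:
  assumes "has_weak_deriv u v"
  shows "has_weak_deriv (\<lambda>x. c *\<^sub>R u x) (\<lambda>x. c *\<^sub>R v x)"
  unfolding has_weak_deriv_def
proof (intro allI impI)
  fix p assume p: "test_fun p"
  have *: "(LINT x|I01. q x *\<^sub>R c *\<^sub>R z x) = c *\<^sub>R (LINT x|I01. q x *\<^sub>R z x)" for q and z :: "real \<Rightarrow> 'a"
    unfolding scaleR_left_commute[of _ c] by (rule integral_scaleR_right)
  show "(LINT x|I01. deriv p x *\<^sub>R c *\<^sub>R u x) = - (LINT x|I01. p x *\<^sub>R c *\<^sub>R v x)"
    using assms p unfolding * by (simp add: has_weak_deriv_def)
qed

lemma H1_weak_deriv:
  assumes "u \<in> H1"
  shows "u \<in> L2" "wderiv u \<in> L2" "has_weak_deriv u (wderiv u)"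
proof -
  have "\<exists>v. v \<in> L2 \<and> has_weak_deriv u v" using assms by (auto simp: H1_def)
  then have "wderiv u \<in> L2 \<and> has_weak_deriv u (wderiv u)"
    unfolding wderiv_def by (rule someI_ex)
  then show "wderiv u \<in> L2" "has_weak_deriv u (wderiv u)" by auto
  show "u \<in> L2" using assms by (simp add: H1_def)
qed

lemma has_weak_deriv_imp_H1:
  assumes "u \<in> L2" "v \<in> L2" "has_weak_deriv u v"
  shows "u \<in> H1" "AE x in I01. wderiv u x = v x"
proof -
  show "u \<in> H1" using assms by (auto simp: H1_def)
  from H1_weak_deriv[OF this] assms show "AE x in I01. wderiv u x = v x"
    by (intro weak_deriv_unique[of u])
qed

section \<open>Continuous representatives and the space of twice weakly differentiable functions\<close>

lemma cont_rep_eq: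
  assumes g: "continuous_on {0..1} g" and ae: "AE x in I01. g x = u x" and x: "x \<in> {0..1}"
  shows "cont_rep u x = g x"
proof -
  have "continuous_on {0..1} (cont_rep u) \<and> (AE x in I01. cont_rep u x = u x)"
    unfolding cont_rep_def by (rule someI[of _ g]) (use g ae in simp)
  then have c: "continuous_on {0..1} (cont_rep u)" and c': "AE x in I01. cont_rep u x = u x" by auto
  from c' ae have "AE x in I01. cont_rep u x = g x" by eventually_elim simp
  from continuous_AE_eq[OF c g this x] show ?thesis .
qed

text \<open>
  Equality almost everywhere makes the defining predicates of the two choices coincide, so the
  representatives are equal as functions on the whole line.
\<close>

lemma cont_rep_cong:
  assumes "AE x in I01. u x = u' x"
  shows "cont_rep u = cont_rep u'"
proof -
  have "(AE x in I01. v x = u x) \<longleftrightarrow> (AE x in I01. v x = u' x)" for v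
  proof
    assume "AE x in I01. v x = u x"
    then show "AE x in I01. v x = u' x" using assms by eventually_elim simp
  next
    assume "AE x in I01. v x = u' x"
    then show "AE x in I01. v x = u x" using assms by eventually_elim simp
  qed
  then show ?thesis unfolding cont_rep_def by simp
qed

lemma cont_rep_weak_deriv:
  assumes u: "u \<in> L2" and v: "v \<in> L2" "has_weak_deriv u v"
  shows "continuous_on {0..1} (cont_rep u)"
    and "AE x in I01. cont_rep u x = u x"
    and "x \<in> {0..1} \<Longrightarrow> cont_rep u x = cont_rep u 0 + prim v x"
proof -
  \<comment> \<open>The continuous representative differs from the primitive by a constant.\<close>
  obtain c where c: "AE x in I01. u x = c + prim v x" using weak_deriv_primitive[OF u v] by blast
  have g: "continuous_on {0..1} (\<lambda>x. c + prim v x)"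
    by (intro continuous_intros continuous_on_prim L2_integrable v)
  have eq: "cont_rep u x = c + prim v x" if "x \<in> {0..1}" for x
    by (rule cont_rep_eq[OF g _ that]) (use c in \<open>eventually_elim, simp\<close>)
  show "continuous_on {0..1} (cont_rep u)" using g by (rule continuous_on_eq) (simp add: eq)
  show "AE x in I01. cont_rep u x = u x"
    using c AE_space[of I01] by eventually_elim (simp add: eq)
  show "x \<in> {0..1} \<Longrightarrow> cont_rep u x = cont_rep u 0 + prim v x" using eq[of x] eq[of 0] by simp
qed

definition sqint :: "(real \<Rightarrow> 'a::euclidean_space) \<Rightarrow> real" where
  "sqint u = (LINT x|I01. (norm (u x))\<^sup>2)"

lemma sqint_nonneg [simp]: "0 \<le> sqint u"
  by (simp add: sqint_def)

lemma sqint_cong: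
  assumes "AE x in I01. u x = v x" "u \<in> L2" "v \<in> L2"
  shows "sqint u = sqint v"
  unfolding sqint_def
  by (rule integral_cong_AE) (use assms in \<open>auto simp: L2_def\<close>)

lemma sqint_scaleR: "sqint (\<lambda>x. c *\<^sub>R u x) = c\<^sup>2 * sqint u"
  by (simp add: sqint_def power_mult_distrib)

lemma sqint_add_le:
  assumes "u \<in> L2" "v \<in> L2"
  shows "sqint (\<lambda>x. u x + v x) \<le> 2 * sqint u + 2 * sqint v"
proof -
  have "sqint (\<lambda>x. u x + v x) \<le> (LINT x|I01. 2 * (norm (u x))\<^sup>2 + 2 * (norm (v x))\<^sup>2)"
    unfolding sqint_def
  proof (rule integral_mono)
    show "integrable I01 (\<lambda>x. (norm (u x + v x))\<^sup>2)" using L2_add[OF assms] by (simp add: L2_def)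
    show "integrable I01 (\<lambda>x. 2 * (norm (u x))\<^sup>2 + 2 * (norm (v x))\<^sup>2)" using assms by (auto simp: L2_def)
    show "(norm (u x + v x))\<^sup>2 \<le> 2 * (norm (u x))\<^sup>2 + 2 * (norm (v x))\<^sup>2" for x
      using power_mono[OF norm_triangle_ineq[of "u x" "v x"] norm_ge_zero, of 2]
        sum_squares_bound[of "norm (u x)" "norm (v x)"] by (simp add: power2_sum)
  qed
  also have "\<dots> = 2 * sqint u + 2 * sqint v"
    using assms by (simp add: sqint_def L2_def)
  finally show ?thesis .
qed

lemma integral_norm_le_sqrt_sqint: "u \<in> L2 \<Longrightarrow> (LINT x|I01. norm (u x)) \<le> sqrt (sqint u)"
  by (rule real_le_rsqrt) (simp add: sqint_def square_integral_norm_le)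

text \<open>
  The one-dimensional Sobolev embedding: a point value differs from any other value by at most the
  \<open>L\<^sup>1\<close> norm of the derivative, and averaging over the other point replaces that value by the
  \<open>L\<^sup>2\<close> norm of the function.
\<close>

lemma cont_rep_bound:
  assumes u: "u \<in> L2" and v: "v \<in> L2" "has_weak_deriv u v" and x: "x \<in> {0..1}"
  shows "(norm (cont_rep u x))\<^sup>2 \<le> 2 * sqint u + 2 * sqint v"
proof -
  note c = cont_rep_weak_deriv[OF u v]
  define D where "D = (LINT t|I01. norm (v t))"
  have "AE y in I01. (norm (cont_rep u x))\<^sup>2 \<le> 2 * (norm (u y))\<^sup>2 + 2 * D\<^sup>2"
    using c(2) AE_space[of I01]
  proof eventually_elim
    case (elim y)
    have "norm (cont_rep u x - cont_rep u y) \<le> D"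
      using c(3)[of x] c(3)[of y] x elim norm_prim_diff_le[OF L2_integrable[OF v(1)], of x y]
      by (simp add: D_def)
    then have "norm (cont_rep u x) \<le> norm (u y) + D"
      using norm_triangle_sub[of "cont_rep u x" "cont_rep u y"] elim by simp
    then have "(norm (cont_rep u x))\<^sup>2 \<le> (norm (u y) + D)\<^sup>2" by (intro power_mono) auto
    also have "\<dots> \<le> 2 * (norm (u y))\<^sup>2 + 2 * D\<^sup>2"
      using sum_squares_bound[of "norm (u y)" D] by (simp add: power2_sum)
    finally show ?case .
  qed
  then have "(LINT y|I01. (norm (cont_rep u x))\<^sup>2) \<le> (LINT y|I01. 2 * (norm (u y))\<^sup>2 + 2 * D\<^sup>2)"
    using u by (intro integral_mono_AE) (auto simp: L2_def)
  also have "\<dots> = 2 * sqint u + 2 * D\<^sup>2"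
    using u by (simp add: L2_def sqint_def)
  also have "D\<^sup>2 \<le> sqint v" unfolding D_def sqint_def by (rule square_integral_norm_le[OF v(1)])
  finally show ?thesis by simp
qed

text \<open>
  The operator \<open>wderiv\<close> is a choice among functions equal almost everywhere, so that
  \<open>wderiv (wderiv (u + v))\<close> is awkward to compute. Carrying a pair of derivatives along explicitly
  turns the vector space structure into statements about functions.
\<close>

definition H2_derivs :: "(real \<Rightarrow> 'a::euclidean_space) \<Rightarrow> (real \<Rightarrow> 'a) \<Rightarrow> (real \<Rightarrow> 'a) \<Rightarrow> bool" where
  "H2_derivs u v w \<longleftrightarrow>
     u \<in> L2 \<and> v \<in> L2 \<and> w \<in> L2 \<and> has_weak_deriv u v \<and> has_weak_deriv v w"

lemma H2_imp_derivs: "u \<in> H2 \<Longrightarrow> H2_derivs u (wderiv u) (wderiv (wderiv u))"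
  by (auto simp: H2_def H2_derivs_def dest: H1_weak_deriv)

lemma H2_derivs_imp:
  assumes "H2_derivs u v w"
  shows "u \<in> H2" "AE x in I01. wderiv u x = v x" "AE x in I01. wderiv (wderiv u) x = w x"
proof -
  have L: "u \<in> L2" "v \<in> L2" "w \<in> L2" and d: "has_weak_deriv u v" "has_weak_deriv v w"
    using assms by (auto simp: H2_derivs_def)
  note u = has_weak_deriv_imp_H1[OF L(1,2) d(1)]
  show ae: "AE x in I01. wderiv u x = v x" by (rule u(2))
  have wL: "wderiv u \<in> L2" using H1_weak_deriv[OF u(1)] by auto
  have "has_weak_deriv (wderiv u) w"
    by (rule has_weak_deriv_cong[OF d(2)]) (use L wL ae in \<open>auto simp: eq_commute\<close>)
  note v = has_weak_deriv_imp_H1[OF wL L(3) this]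
  show "u \<in> H2" using u v by (simp add: H2_def)
  show "AE x in I01. wderiv (wderiv u) x = w x" by (rule v(2))
qed

lemma H2_derivs_add:
  "H2_derivs u v w \<Longrightarrow> H2_derivs u' v' w' \<Longrightarrow>
   H2_derivs (\<lambda>x. u x + u' x) (\<lambda>x. v x + v' x) (\<lambda>x. w x + w' x)"
  by (simp add: H2_derivs_def L2_add has_weak_deriv_add)

lemma H2_derivs_scaleR:
  "H2_derivs u v w \<Longrightarrow> H2_derivs (\<lambda>x. c *\<^sub>R u x) (\<lambda>x. c *\<^sub>R v x) (\<lambda>x. c *\<^sub>R w x)"
  by (simp add: H2_derivs_def L2_scaleR has_weak_deriv_scaleR)

lemma H2_derivs_diff:
  assumes "H2_derivs u v w" "H2_derivs u' v' w'"
  shows "H2_derivs (\<lambda>x. u x - u' x) (\<lambda>x. v x - v' x) (\<lambda>x. w x - w' x)"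
  using H2_derivs_add[OF assms(1) H2_derivs_scaleR[OF assms(2), of "-1"]] by simp

lemma H2_norm_nonneg [simp]: "0 \<le> H2_norm u"
  by (simp add: H2_norm_def)

lemma H2_norm_square:
  assumes "H2_derivs u v w"
  shows "(H2_norm u)\<^sup>2 = sqint u + sqint v + sqint w"
proof -
  have "(H2_norm u)\<^sup>2 = sqint u + sqint (wderiv u) + sqint (wderiv (wderiv u))"
    by (simp add: H2_norm_def sqint_def)
  moreover have "sqint (wderiv u) = sqint v" "sqint (wderiv (wderiv u)) = sqint w"
    using assms H2_derivs_imp[OF assms] H2_imp_derivs[of u]
    by (auto intro!: sqint_cong simp: H2_derivs_def)
  ultimately show ?thesis by simp
qed

lemma H2_norm_add_square_le:
  assumes "u \<in> H2" "u' \<in> H2"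
  shows "(H2_norm (\<lambda>x. u x + u' x))\<^sup>2 \<le> 2 * (H2_norm u)\<^sup>2 + 2 * (H2_norm u')\<^sup>2"
proof -
  note d = H2_imp_derivs[OF assms(1)] H2_imp_derivs[OF assms(2)]
  note s = H2_derivs_add[OF d]
  have "sqint (\<lambda>x. u x + u' x) \<le> 2 * sqint u + 2 * sqint u'"
    "sqint (\<lambda>x. wderiv u x + wderiv u' x) \<le> 2 * sqint (wderiv u) + 2 * sqint (wderiv u')"
    "sqint (\<lambda>x. wderiv (wderiv u) x + wderiv (wderiv u') x)
      \<le> 2 * sqint (wderiv (wderiv u)) + 2 * sqint (wderiv (wderiv u'))"
    using d by (auto intro!: sqint_add_le simp: H2_derivs_def)
  then show ?thesis
    unfolding H2_norm_square[OF s] H2_norm_square[OF d(1)] H2_norm_square[OF d(2)] distrib_left by linarith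
qed

lemma H2_norm_scaleR:
  assumes "u \<in> H2"
  shows "H2_norm (\<lambda>x. c *\<^sub>R u x) = \<bar>c\<bar> * H2_norm u"
proof -
  note d = H2_imp_derivs[OF assms]
  have "(H2_norm (\<lambda>x. c *\<^sub>R u x))\<^sup>2 = (\<bar>c\<bar> * H2_norm u)\<^sup>2"
    unfolding H2_norm_square[OF H2_derivs_scaleR[OF d]] power_mult_distrib H2_norm_square[OF d]
    by (simp add: sqint_scaleR algebra_simps)
  then show ?thesis by (intro power2_eq_imp_eq[of "H2_norm _"]) auto
qed

lemma H2_add: "u \<in> H2 \<Longrightarrow> v \<in> H2 \<Longrightarrow> (\<lambda>x. u x + v x) \<in> H2"
  by (rule H2_derivs_imp(1)[OF H2_derivs_add[OF H2_imp_derivs H2_imp_derivs]])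

lemma H2_diff: "u \<in> H2 \<Longrightarrow> v \<in> H2 \<Longrightarrow> (\<lambda>x. u x - v x) \<in> H2"
  by (rule H2_derivs_imp(1)[OF H2_derivs_diff[OF H2_imp_derivs H2_imp_derivs]])

lemma H2_scaleR: "u \<in> H2 \<Longrightarrow> (\<lambda>x. c *\<^sub>R u x) \<in> H2"
  by (rule H2_derivs_imp(1)[OF H2_derivs_scaleR[OF H2_imp_derivs]])

lemma cont_rep_H2:
  assumes "u \<in> H2"
  shows "continuous_on {0..1} (cont_rep u)" "AE x in I01. cont_rep u x = u x"
    "continuous_on {0..1} (cont_rep (wderiv u))" "AE x in I01. cont_rep (wderiv u) x = wderiv u x"
  using H2_imp_derivs[OF assms] cont_rep_weak_deriv unfolding H2_derivs_def by blast+

lemma trace_add_scaleR: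
  assumes "u \<in> H2" "v \<in> H2" "x \<in> {0..1}"
  shows "cont_rep (\<lambda>x. u x + c *\<^sub>R v x) x = cont_rep u x + c *\<^sub>R cont_rep v x"
    and "cont_rep (wderiv (\<lambda>x. u x + c *\<^sub>R v x)) x = cont_rep (wderiv u) x + c *\<^sub>R cont_rep (wderiv v) x"
proof -
  note d = H2_derivs_add[OF H2_imp_derivs[OF assms(1)] H2_derivs_scaleR[OF H2_imp_derivs[OF assms(2)], of c]]
  note cu = cont_rep_H2[OF assms(1)] and cv = cont_rep_H2[OF assms(2)]
  show "cont_rep (\<lambda>x. u x + c *\<^sub>R v x) x = cont_rep u x + c *\<^sub>R cont_rep v x"
  proof (rule cont_rep_eq[OF _ _ assms(3)])
    show "continuous_on {0..1} (\<lambda>x. cont_rep u x + c *\<^sub>R cont_rep v x)"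
      by (intro continuous_intros cu cv)
    show "AE x in I01. cont_rep u x + c *\<^sub>R cont_rep v x = u x + c *\<^sub>R v x"
      using cu(2) cv(2) by eventually_elim simp
  qed
  show "cont_rep (wderiv (\<lambda>x. u x + c *\<^sub>R v x)) x = cont_rep (wderiv u) x + c *\<^sub>R cont_rep (wderiv v) x"
    unfolding cont_rep_cong[OF H2_derivs_imp(2)[OF d]]
  proof (rule cont_rep_eq[OF _ _ assms(3)])
    show "continuous_on {0..1} (\<lambda>x. cont_rep (wderiv u) x + c *\<^sub>R cont_rep (wderiv v) x)"
      by (intro continuous_intros cu cv)
    show "AE x in I01. cont_rep (wderiv u) x + c *\<^sub>R cont_rep (wderiv v) x = wderiv u x + c *\<^sub>R wderiv v x"
      using cu(4) cv(4) by eventually_elim simp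
  qed
qed

lemma trace_bound:
  assumes "u \<in> H2" "x \<in> {0..1}"
  shows "norm (cont_rep u x) \<le> 2 * H2_norm u" "norm (cont_rep (wderiv u) x) \<le> 2 * H2_norm u"
proof -
  note d = H2_imp_derivs[OF assms(1)]
  have dd: "u \<in> L2" "wderiv u \<in> L2" "wderiv (wderiv u) \<in> L2"
    "has_weak_deriv u (wderiv u)" "has_weak_deriv (wderiv u) (wderiv (wderiv u))"
    using d by (auto simp: H2_derivs_def)
  have four: "(2::real)\<^sup>2 = 4" by simp
  have "(norm (cont_rep u x))\<^sup>2 \<le> (2 * H2_norm u)\<^sup>2"
    using cont_rep_bound[OF dd(1,2,4) assms(2)] sqint_nonneg[of u]
      sqint_nonneg[of "wderiv u"] sqint_nonneg[of "wderiv (wderiv u)"]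
    unfolding power_mult_distrib H2_norm_square[OF d] distrib_left four by linarith
  then show "norm (cont_rep u x) \<le> 2 * H2_norm u" by (rule power2_le_imp_le) simp
  have "(norm (cont_rep (wderiv u) x))\<^sup>2 \<le> (2 * H2_norm u)\<^sup>2"
    using cont_rep_bound[OF dd(2,3,5) assms(2)] sqint_nonneg[of u]
      sqint_nonneg[of "wderiv u"] sqint_nonneg[of "wderiv (wderiv u)"]
    unfolding power_mult_distrib H2_norm_square[OF d] distrib_left four by linarith
  then show "norm (cont_rep (wderiv u) x) \<le> 2 * H2_norm u" by (rule power2_le_imp_le) simp
qed

lemma AE_wderiv_bound:
  assumes "u \<in> H2"
  shows "AE x in I01. norm (wderiv u x) \<le> 2 * H2_norm u"
  using cont_rep_H2(4)[OF assms] AE_space[of I01]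
proof eventually_elim
  case (elim x)
  then show ?case using trace_bound(2)[OF assms, of x] by simp
qed

lemma H2_0_add_scaleR:
  assumes "g \<in> H2_0" "h \<in> H2_0"
  shows "(\<lambda>x. g x + c *\<^sub>R h x) \<in> H2_0"
  using assms by (simp add: H2_0_def trace_add_scaleR H2_add H2_scaleR)

lemma H2_0_scaleR:
  assumes "h \<in> H2_0"
  shows "(\<lambda>x. c *\<^sub>R h x) \<in> H2_0"
  using H2_0_add_scaleR[OF assms assms, of "c - 1"] by (simp add: scaleR_left_diff_distrib)

text \<open>
  The boundary conditions at the left end are what makes the Carleman estimate possible: because
  the constant of integration vanishes, the first derivative is recovered from the second one by
  integration from \<open>0\<close>, the end at which the weight is largest.
\<close>

lemma H2_0_wderiv_prim:
  assumes "h \<in> H2_0"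
  shows "AE x in I01. wderiv h x = prim (wderiv (wderiv h)) x"
proof -
  have h: "h \<in> H2" "cont_rep (wderiv h) 0 = 0" using assms by (auto simp: H2_0_def)
  note d = H2_imp_derivs[OF h(1)]
  note c = cont_rep_weak_deriv[of "wderiv h" "wderiv (wderiv h)"]
  from cont_rep_H2(4)[OF h(1)] AE_space[of I01] show ?thesis
    by eventually_elim (use c(3) d h in \<open>simp add: H2_derivs_def\<close>)
qed

lemma sqint_le_if_trace_zero:
  assumes u: "u \<in> L2" and v: "v \<in> L2" "has_weak_deriv u v" and 0: "cont_rep u 0 = 0"
  shows "sqint u \<le> sqint v"
proof -
  note c = cont_rep_weak_deriv[OF u v]
  have "AE x in I01. (norm (u x))\<^sup>2 \<le> sqint v"
    using c(2) AE_space[of I01]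
  proof eventually_elim
    case (elim x)
    have "norm (u x) \<le> (LINT t|I01. norm (v t))"
      using norm_prim_diff_le[OF L2_integrable[OF v(1)], of x 0] elim c(3)[of x] 0 by simp
    then have "(norm (u x))\<^sup>2 \<le> (LINT t|I01. norm (v t))\<^sup>2" by (intro power_mono) auto
    also have "\<dots> \<le> sqint v" unfolding sqint_def by (rule square_integral_norm_le[OF v(1)])
    finally show ?case .
  qed
  then have "sqint u \<le> (LINT x|I01. sqint v)"
    unfolding sqint_def[of u] using u by (intro integral_mono_AE) (auto simp: L2_def)
  then show ?thesis by simp
qed

text \<open>
  This Poincare inequality produces the constant of the convexity estimate: the integral in
  the functional provides a bound for the second derivative.
\<close>

lemma H2_0_norm_le:
  assumes "h \<in> H2_0"
  shows "(H2_norm h)\<^sup>2 \<le> 3 * sqint (wderiv (wderiv h))"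
proof -
  have h: "h \<in> H2" "cont_rep h 0 = 0" "cont_rep (wderiv h) 0 = 0" using assms by (auto simp: H2_0_def)
  note d = H2_imp_derivs[OF h(1)]
  have "sqint h \<le> sqint (wderiv h)" "sqint (wderiv h) \<le> sqint (wderiv (wderiv h))"
    using d h by (auto intro!: sqint_le_if_trace_zero simp: H2_derivs_def)
  then show ?thesis unfolding H2_norm_square[OF d] by linarith
qed

section \<open>The ball of admissible functions and its closure\<close>

text \<open>
  Integration by parts: the boundary terms vanish because test functions do at both ends.
\<close>

lemma classical_imp_weak_deriv:
  fixes f f' :: "real \<Rightarrow> 'a::euclidean_space"
  assumes f: "\<And>x. x \<in> {0..1} \<Longrightarrow> (f has_vector_derivative f' x) (at x within {0..1})"
    and f': "continuous_on {0..1} f'"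
  shows "has_weak_deriv f f'"
  unfolding has_weak_deriv_def
proof (intro allI impI)
  fix p assume p: "test_fun p"
  have cf: "continuous_on {0..1} f"
    unfolding continuous_on_eq_continuous_within
    using f has_vector_derivative_continuous by blast
  have i: "integrable I01 (\<lambda>x. p x *\<^sub>R f' x)" "integrable I01 (\<lambda>x. deriv p x *\<^sub>R f x)"
    by (intro integrable_continuous_scaleR test_fun_continuous[OF p] L2_integrable L2_continuous f' cf)+
  have dp: "(p has_real_derivative deriv p x) (at x within {0..1})" for x
    using p DERIV_deriv_iff_real_differentiable has_field_derivative_at_within
    unfolding test_fun_def by blast
  have p0: "p 0 = 0" "p 1 = 0" using p by (force simp: test_fun_def)+
  have "((\<lambda>x. p x *\<^sub>R f' x + deriv p x *\<^sub>R f x) has_integral (p 1 *\<^sub>R f 1 - p 0 *\<^sub>R f 0)) {0..1}"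
    by (rule fundamental_theorem_of_calculus)
       (auto intro!: has_vector_derivative_scaleR dp f)
  then have "integral {0<..<1} (\<lambda>x. p x *\<^sub>R f' x + deriv p x *\<^sub>R f x) = 0"
    using p0 by (simp add: integral_open_interval_real[symmetric] integral_unique)
  moreover have "(LINT x|I01. p x *\<^sub>R f' x + deriv p x *\<^sub>R f x)
      = integral {0<..<1} (\<lambda>x. p x *\<^sub>R f' x + deriv p x *\<^sub>R f x)"
    by (rule lebesgue_integral_eq_integral) (use i in auto)
  ultimately have "(LINT x|I01. p x *\<^sub>R f' x) + (LINT x|I01. deriv p x *\<^sub>R f x) = 0"
    using i by simp
  then show "(LINT x|I01. deriv p x *\<^sub>R f x) = - (LINT x|I01. p x *\<^sub>R f' x)"
    by (simp add: eq_neg_iff_add_eq_0 add.commute)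
qed

lemma bdry_ext_H2:
  fixes f0 f1 :: "'a::euclidean_space"
  assumes "cutoff c"
  shows "bdry_ext c f0 f1 \<in> H2"
proof -
  obtain c' c'' where c: "\<And>x. x \<in> {0..1} \<Longrightarrow> (c has_real_derivative c' x) (at x within {0..1})"
    and c': "\<And>x. x \<in> {0..1} \<Longrightarrow> (c' has_real_derivative c'' x) (at x within {0..1})"
    and c'': "continuous_on {0..1} c''"
    using assms unfolding cutoff_def by blast
  have co: "continuous_on {0..1} c" "continuous_on {0..1} c'"
    by (rule DERIV_continuous_on[OF c]; simp) (rule DERIV_continuous_on[OF c']; simp)
  define l where "l x = f0 + x *\<^sub>R f1" for x
  have l: "(l has_vector_derivative f1) (at x within {0..1})" for x
    unfolding l_def by (auto intro!: derivative_eq_intros)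
  have cl: "continuous_on {0..1} l" unfolding l_def by (intro continuous_intros)
  define g where "g x = c x *\<^sub>R l x" for x
  define g' where "g' x = c x *\<^sub>R f1 + c' x *\<^sub>R l x" for x
  define g'' where "g'' x = c' x *\<^sub>R f1 + (c' x *\<^sub>R f1 + c'' x *\<^sub>R l x)" for x
  have g: "(g has_vector_derivative g' x) (at x within {0..1})" if "x \<in> {0..1}" for x
    unfolding g_def g'_def by (intro has_vector_derivative_scaleR l c that)
  have "((\<lambda>x. c x *\<^sub>R f1) has_vector_derivative c' x *\<^sub>R f1) (at x within {0..1})" if "x \<in> {0..1}" for x
    using has_vector_derivative_scaleR[OF c[OF that] has_vector_derivative_const[of f1]] by simp
  then have g': "(g' has_vector_derivative g'' x) (at x within {0..1})" if "x \<in> {0..1}" for x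
    unfolding g'_def g''_def
    using that by (intro has_vector_derivative_add has_vector_derivative_scaleR[OF c' l]) auto
  have cg: "continuous_on {0..1} g" "continuous_on {0..1} g'" "continuous_on {0..1} g''"
    unfolding g_def g'_def g''_def by (intro continuous_intros co c'' cl)+
  have "H2_derivs g g' g''"
    unfolding H2_derivs_def
    by (intro conjI L2_continuous cg classical_imp_weak_deriv g g')
  moreover have "g = bdry_ext c f0 f1" by (auto simp: g_def l_def bdry_ext_def)
  ultimately show ?thesis using H2_derivs_imp(1) by blast
qed

text \<open>
  Traces are continuous on \<open>H\<^sup>2\<close>, so that the boundary conditions survive the closure.
\<close>

lemma H2_closure_B_traces:
  assumes "y \<in> H2_closure (B_set c R f0 f1)"
  shows "y \<in> H2" "cont_rep y 0 = f0" "cont_rep (wderiv y) 0 = f1" "cont_rep (wderiv y) 1 = 0"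
proof -
  show y: "y \<in> H2" using assms by (simp add: H2_closure_def)
  have *: "a = b" if "\<And>e. e > 0 \<Longrightarrow> norm (a - b) \<le> 2 * e" for a b :: 'a
  proof (rule ccontr)
    assume "a \<noteq> b"
    then show False using that[of "norm (a - b) / 4"] by simp
  qed
  have ap: "\<exists>v\<in>B_set c R f0 f1. v \<in> H2 \<and> H2_norm (\<lambda>x. y x - v x) < e" if "e > 0" for e
    using assms that by (force simp: H2_closure_def B_set_def)
  show "cont_rep y 0 = f0"
  proof (rule *)
    fix e :: real assume "e > 0"
    then obtain v where v: "v \<in> B_set c R f0 f1" "v \<in> H2" "H2_norm (\<lambda>x. y x - v x) < e"
      using ap by blast
    then show "norm (cont_rep y 0 - f0) \<le> 2 * e"
      using trace_bound(1)[OF H2_diff[OF y v(2)], of 0] trace_add_scaleR(1)[OF y v(2), of 0 "-1"]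
      by (simp add: B_set_def)
  qed
  show "cont_rep (wderiv y) 0 = f1"
  proof (rule *)
    fix e :: real assume "e > 0"
    then obtain v where v: "v \<in> B_set c R f0 f1" "v \<in> H2" "H2_norm (\<lambda>x. y x - v x) < e"
      using ap by blast
    then show "norm (cont_rep (wderiv y) 0 - f1) \<le> 2 * e"
      using trace_bound(2)[OF H2_diff[OF y v(2)], of 0] trace_add_scaleR(2)[OF y v(2), of 0 "-1"]
      by (simp add: B_set_def)
  qed
  show "cont_rep (wderiv y) 1 = 0"
  proof (rule *)
    fix e :: real assume "e > 0"
    then obtain v where v: "v \<in> B_set c R f0 f1" "v \<in> H2" "H2_norm (\<lambda>x. y x - v x) < e"
      using ap by blast
    then show "norm (cont_rep (wderiv y) 1 - 0) \<le> 2 * e"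
      using trace_bound(2)[OF H2_diff[OF y v(2)], of 1] trace_add_scaleR(2)[OF y v(2), of 1 "-1"]
      by (simp add: B_set_def)
  qed
qed

lemma H2_closure_B_diff:
  assumes "y1 \<in> H2_closure (B_set c R f0 f1)" "y2 \<in> H2_closure (B_set c R f0 f1)"
  shows "(\<lambda>x. y2 x - y1 x) \<in> H2_0"
proof -
  note t1 = H2_closure_B_traces[OF assms(1)] and t2 = H2_closure_B_traces[OF assms(2)]
  show ?thesis
    using trace_add_scaleR[OF t2(1) t1(1), of _ "-1"] t1 t2 by (simp add: H2_0_def H2_diff)
qed

text \<open>
  The ball is centred at the extension of the boundary data, which lies in \<open>H\<^sup>2\<close>. The bound
  depends on the data and the cut-off function through the norm of that extension.
\<close>

lemma H2_closure_B_bounded: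
  assumes "cutoff c"
  shows "\<exists>K\<ge>0. \<forall>y\<in>H2_closure (B_set c R f0 f1). H2_norm y \<le> K"
proof -
  define f where "f = bdry_ext c f0 f1"
  have f: "f \<in> H2" unfolding f_def by (rule bdry_ext_H2[OF assms])
  define K where "K = sqrt (2 + 4 * R\<^sup>2 + 4 * (H2_norm f)\<^sup>2)"
  have "H2_norm y \<le> K" if y: "y \<in> H2_closure (B_set c R f0 f1)" for y
  proof -
    obtain v where v: "v \<in> B_set c R f0 f1" and yv: "H2_norm (\<lambda>x. y x - v x) < 1"
      using y zero_less_one unfolding H2_closure_def by blast
    have y: "y \<in> H2" using y by (simp add: H2_closure_def)
    have vH: "v \<in> H2" and vf: "H2_norm (\<lambda>x. v x - f x) < R" using v by (auto simp: B_set_def f_def)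
    have "(H2_norm v)\<^sup>2 \<le> 2 * (H2_norm (\<lambda>x. v x - f x))\<^sup>2 + 2 * (H2_norm f)\<^sup>2"
      using H2_norm_add_square_le[OF H2_diff[OF vH f] f] by simp
    moreover have "(H2_norm (\<lambda>x. v x - f x))\<^sup>2 \<le> R\<^sup>2" using vf by (intro power_mono) auto
    moreover have "(H2_norm (\<lambda>x. y x - v x))\<^sup>2 \<le> 1\<^sup>2" using yv by (intro power_mono) auto
    moreover have "(H2_norm y)\<^sup>2 \<le> 2 * (H2_norm (\<lambda>x. y x - v x))\<^sup>2 + 2 * (H2_norm v)\<^sup>2"
      using H2_norm_add_square_le[OF H2_diff[OF y vH] vH] by simp
    ultimately have "(H2_norm y)\<^sup>2 \<le> 2 + 4 * R\<^sup>2 + 4 * (H2_norm f)\<^sup>2" unfolding one_power2 by linarith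
    then show ?thesis unfolding K_def by (rule real_le_rsqrt)
  qed
  then show ?thesis by (intro exI[of _ K]) (auto simp: K_def)
qed

section \<open>The Carleman estimate\<close>

lemma continuous_weight: "continuous_on S (\<lambda>x::real. exp (c * x))"
  by (intro continuous_intros)

lemma weight_measurable: "(\<lambda>x::real. exp (c * x)) \<in> borel_measurable I01"
  by (rule continuous_imp_measurable_I01[OF continuous_weight])

lemma weight_le_1: "0 \<le> lam \<Longrightarrow> x \<in> {0<..<1} \<Longrightarrow> exp (- 2 * lam * x) \<le> (1::real)"
  by simp

lemma integrable_weighted:
  fixes f :: "real \<Rightarrow> real"
  assumes "integrable I01 f" "0 \<le> lam"
  shows "integrable I01 (\<lambda>x. f x * exp (- 2 * lam * x))"
  by (rule integrable_I01_bounded_real[OF assms(1) weight_measurable, where K = 1])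
     (use weight_le_1[OF assms(2)] in auto)

lemma integral_weighted_inner_le:
  fixes u v :: "real \<Rightarrow> 'a::euclidean_space"
  assumes u: "u \<in> L2" and v: "v \<in> L2" and lam: "0 \<le> lam"
  shows "\<bar>LINT x|I01. (u x \<bullet> v x) * exp (- 2 * lam * x)\<bar> \<le> sqrt (sqint u) * sqrt (sqint v)"
proof -
  have "\<bar>LINT x|I01. (u x \<bullet> v x) * exp (- 2 * lam * x)\<bar> \<le> (LINT x|I01. \<bar>(u x \<bullet> v x) * exp (- 2 * lam * x)\<bar>)"
    by (rule integral_abs_bound)
  also have "\<dots> \<le> (LINT x|I01. norm (u x) * norm (v x))"
  proof (rule integral_mono)
    show "integrable I01 (\<lambda>x. \<bar>(u x \<bullet> v x) * exp (- 2 * lam * x)\<bar>)"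
      by (intro integrable_abs integrable_weighted L2_inner_integrable u v lam)
    show "integrable I01 (\<lambda>x. norm (u x) * norm (v x))"
      by (rule L2_norm_mult_integrable[OF u v])
    show "\<bar>(u x \<bullet> v x) * exp (- 2 * lam * x)\<bar> \<le> norm (u x) * norm (v x)" if "x \<in> space I01" for x
    proof -
      have "\<bar>u x \<bullet> v x\<bar> * exp (- 2 * lam * x) \<le> (norm (u x) * norm (v x)) * 1"
        using weight_le_1[OF lam, of x] that Cauchy_Schwarz_ineq2[of "u x" "v x"]
        by (intro mult_mono) auto
      then show ?thesis by (simp add: abs_mult)
    qed
  qed
  also have "\<dots> \<le> sqrt ((LINT x|I01. (norm (u x))\<^sup>2) * (LINT x|I01. (norm (v x))\<^sup>2))"
    by (rule real_le_rsqrt[OF Cauchy_Schwarz_I01[OF L2_norm[OF u] L2_norm[OF v]]])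
  finally show ?thesis by (simp add: real_sqrt_mult sqint_def)
qed

text \<open>
  The primitive is computed by reading the derivative of an exponential as a weak derivative.
\<close>

lemma prim_exp_le:
  assumes "0 < lam" "x \<in> {0..1}"
  shows "prim (\<lambda>t. exp (2 * lam * t)) x \<le> exp (2 * lam * x) / (2 * lam)"
proof -
  define f where "f t = exp (2 * lam * t) / (2 * lam)" for t
  have "(f has_real_derivative exp (2 * lam * t)) (at t within {0..1})" for t
    unfolding f_def using assms(1) by (auto intro!: derivative_eq_intros)
  then have w: "has_weak_deriv f (\<lambda>t. exp (2 * lam * t))"
    by (intro classical_imp_weak_deriv continuous_weight)
       (auto simp: has_real_derivative_iff_has_vector_derivative)
  have cf: "continuous_on {0..1} f" unfolding f_def using assms(1) by (intro continuous_intros) auto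
  have eq: "cont_rep f t = f t" if "t \<in> {0..1}" for t
    by (rule cont_rep_eq[OF cf _ that]) simp
  have "f x = f 0 + prim (\<lambda>t. exp (2 * lam * t)) x"
    using cont_rep_weak_deriv(3)[OF L2_continuous[OF cf] L2_continuous[OF continuous_weight] w assms(2)]
      eq[OF assms(2)] eq[of 0] by simp
  moreover have "f 0 \<ge> 0" using assms(1) by (simp add: f_def)
  ultimately show ?thesis by (simp add: f_def)
qed

text \<open>
  The pointwise Carleman estimate. It is the Cauchy-Schwarz inequality after inserting
  \<open>exp (- lam t) exp (lam t)\<close> in the integral of \<open>norm (v t)\<close> over \<open>[0, x]\<close>: the second factor contributes
  at most \<open>exp (2 lam x) / (2 lam)\<close>, whose exponential cancels against the weight at \<open>x\<close>. The gain
  \<open>1 / (2 lam)\<close> is uniform in \<open>x\<close>, and this is essential: the factors multiplying \<open>norm (prim v x)\<^sup>2\<close>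
  later on are integrable but unbounded.
\<close>

lemma carleman_pointwise:
  fixes v :: "real \<Rightarrow> 'a::euclidean_space"
  assumes v: "v \<in> L2" and lam: "0 < lam" and x: "x \<in> {0..1}"
  shows "(norm (prim v x))\<^sup>2 * exp (- 2 * lam * x)
       \<le> (LINT t|I01. (norm (v t))\<^sup>2 * exp (- 2 * lam * t)) / (2 * lam)"
proof -
  define W where "W = (LINT t|I01. (norm (v t))\<^sup>2 * exp (- 2 * lam * t))"
  have W0: "W \<ge> 0" by (simp add: W_def)
  \<comment> \<open>The product of \<open>f\<close> and \<open>g\<close> is the norm of \<open>v\<close> cut off at \<open>x\<close>.\<close>
  define f where "f t = norm (v t) * exp (- lam * t)" for t
  define g where "g t = indicat_real {..x} t * exp (lam * t)" for t
  have m: "(\<lambda>t. exp (c * t)) \<in> borel_measurable I01" for c :: real by (rule weight_measurable)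
  have f: "f \<in> L2"
  proof (rule L2_bound[where v = v and K = 1])
    show "f \<in> borel_measurable I01" unfolding f_def using v m[of "- lam"] by measurable
    show "AE t in I01. norm (f t) \<le> 1 * norm (v t)"
      using AE_space[of I01]
    proof eventually_elim
      case (elim t)
      then have "norm (v t) * exp (- lam * t) \<le> norm (v t) * 1"
        using lam by (intro mult_left_mono) auto
      then show ?case by (simp add: f_def abs_mult)
    qed
  qed (rule v)
  have g: "g \<in> L2"
  proof (rule L2_bounded[where K = "exp lam"])
    show "g \<in> borel_measurable I01" unfolding g_def
      by (intro borel_measurable_times indicator_measurable_I01 m) simp
    show "AE t in I01. norm (g t) \<le> exp lam"
      using AE_space[of I01] by eventually_elim (use lam in \<open>auto simp: g_def indicator_def\<close>)
  qed
  have "norm (prim v x) \<le> prim (\<lambda>t. norm (v t)) x"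
    by (rule norm_prim_le[OF L2_integrable[OF v]])
  also have "\<dots> = (LINT t|I01. f t * g t)"
    unfolding prim_def f_def g_def
    by (intro Bochner_Integration.integral_cong refl) (simp add: exp_minus)
  finally have "(norm (prim v x))\<^sup>2 \<le> (LINT t|I01. f t * g t)\<^sup>2" by (intro power_mono) auto
  also have "\<dots> \<le> (LINT t|I01. (f t)\<^sup>2) * (LINT t|I01. (g t)\<^sup>2)"
    by (rule Cauchy_Schwarz_I01[OF f g])
  also have "(LINT t|I01. (f t)\<^sup>2) = W"
    unfolding W_def f_def
    by (intro Bochner_Integration.integral_cong refl)
       (simp add: power_mult_distrib exp_double[symmetric] mult.assoc)
  also have "(LINT t|I01. (g t)\<^sup>2) = prim (\<lambda>t. exp (2 * lam * t)) x"
    unfolding prim_def g_def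
    by (intro Bochner_Integration.integral_cong refl)
       (simp add: power_mult_distrib exp_double[symmetric] mult.assoc indicator_def)
  also have "W * prim (\<lambda>t. exp (2 * lam * t)) x \<le> W * (exp (2 * lam * x) / (2 * lam))"
    by (intro mult_left_mono prim_exp_le lam x W0)
  finally have "(norm (prim v x))\<^sup>2 * exp (- 2 * lam * x)
      \<le> W * (exp (2 * lam * x) / (2 * lam)) * exp (- 2 * lam * x)"
    by (intro mult_right_mono) auto
  also have "\<dots> = W / (2 * lam)" by (simp add: exp_minus)
  finally show ?thesis by (simp add: W_def)
qed


section \<open>The functional for a quadratic nonlinearity\<close>

text \<open>
  The nonlinearity is kept abstract here. The relevant class consists of the sums of a quadratic and
  a linear map on a Euclidean space, for which the expansion of the residual is exact.
\<close>

definition carleman_functional ::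
    "('a::euclidean_space \<Rightarrow> 'a) \<Rightarrow> real \<Rightarrow> real \<Rightarrow> (real \<Rightarrow> 'a) \<Rightarrow> real" where
  "carleman_functional F lam a y =
     exp (2 * lam) * (LINT x|I01. (norm (wderiv (wderiv y) x + F (wderiv y x)))\<^sup>2 * exp (- 2 * lam * x))
     + a * (H2_norm y)\<^sup>2"

text \<open>
  The inner product that induces the norm of \<open>H\<^sup>2\<close>.
\<close>

definition H2_inner :: "(real \<Rightarrow> 'a::euclidean_space) \<Rightarrow> (real \<Rightarrow> 'a) \<Rightarrow> real" where
  "H2_inner u v = (LINT x|I01. u x \<bullet> v x) + (LINT x|I01. wderiv u x \<bullet> wderiv v x)
     + (LINT x|I01. wderiv (wderiv u) x \<bullet> wderiv (wderiv v) x)"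

lemma sqint_add_eq:
  assumes "u \<in> L2" "v \<in> L2"
  shows "sqint (\<lambda>x. u x + v x) = sqint u + 2 * (LINT x|I01. u x \<bullet> v x) + sqint v"
proof -
  have "sqint (\<lambda>x. u x + v x) = (LINT x|I01. (norm (u x))\<^sup>2 + 2 * (u x \<bullet> v x) + (norm (v x))\<^sup>2)"
    unfolding sqint_def
    by (intro Bochner_Integration.integral_cong refl)
       (simp add: power2_norm_eq_inner inner_add_left inner_add_right inner_commute)
  also have "\<dots> = sqint u + 2 * (LINT x|I01. u x \<bullet> v x) + sqint v"
    using assms L2_inner_integrable[OF assms] by (simp add: sqint_def L2_def)
  finally show ?thesis .
qed

lemma H2_norm_add_square:
  assumes "u \<in> H2" "v \<in> H2"
  shows "(H2_norm (\<lambda>x. u x + v x))\<^sup>2 = (H2_norm u)\<^sup>2 + 2 * H2_inner u v + (H2_norm v)\<^sup>2"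
proof -
  note d = H2_imp_derivs[OF assms(1)] H2_imp_derivs[OF assms(2)]
  have L: "u \<in> L2" "v \<in> L2" "wderiv u \<in> L2" "wderiv v \<in> L2"
    "wderiv (wderiv u) \<in> L2" "wderiv (wderiv v) \<in> L2"
    using d by (auto simp: H2_derivs_def)
  show ?thesis
    unfolding H2_norm_square[OF H2_derivs_add[OF d]] H2_norm_square[OF d(1)] H2_norm_square[OF d(2)]
    by (simp add: H2_inner_def sqint_add_eq[OF L(1,2)] sqint_add_eq[OF L(3,4)] sqint_add_eq[OF L(5,6)])
qed

lemma integral_inner_add_scaleR:
  assumes "u \<in> L2" "v \<in> L2" "v' \<in> L2" "z \<in> L2" "AE x in I01. z x = v x + c *\<^sub>R v' x"
  shows "(LINT x|I01. u x \<bullet> z x) = (LINT x|I01. u x \<bullet> v x) + c * (LINT x|I01. u x \<bullet> v' x)"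
proof -
  have "(LINT x|I01. u x \<bullet> z x) = (LINT x|I01. u x \<bullet> v x + c * (u x \<bullet> v' x))"
  proof (rule integral_cong_AE)
    show "AE x in I01. u x \<bullet> z x = u x \<bullet> v x + c * (u x \<bullet> v' x)"
      using assms(5) by eventually_elim (simp add: inner_add_right)
  qed (use assms in \<open>auto simp: L2_def\<close>)
  also have "\<dots> = (LINT x|I01. u x \<bullet> v x) + c * (LINT x|I01. u x \<bullet> v' x)"
    using L2_inner_integrable[OF assms(1,2)] L2_inner_integrable[OF assms(1,3)] by simp
  finally show ?thesis .
qed

lemma wderiv_add_scaleR:
  assumes "u \<in> H2" "v \<in> H2"
  shows "AE x in I01. wderiv (\<lambda>x. u x + c *\<^sub>R v x) x = wderiv u x + c *\<^sub>R wderiv v x"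
    and "AE x in I01. wderiv (wderiv (\<lambda>x. u x + c *\<^sub>R v x)) x
           = wderiv (wderiv u) x + c *\<^sub>R wderiv (wderiv v) x"
  using H2_derivs_imp[OF H2_derivs_add[OF H2_imp_derivs[OF assms(1)]
        H2_derivs_scaleR[OF H2_imp_derivs[OF assms(2)], of c]]] by auto

lemma H2_inner_add_scaleR:
  assumes u: "u \<in> H2" and g: "g \<in> H2" and h: "h \<in> H2"
  shows "H2_inner u (\<lambda>x. g x + c *\<^sub>R h x) = H2_inner u g + c * H2_inner u h"
proof -
  have gh: "(\<lambda>x. g x + c *\<^sub>R h x) \<in> H2" by (intro H2_add H2_scaleR g h)
  have L: "z \<in> L2" "wderiv z \<in> L2" "wderiv (wderiv z) \<in> L2" if "z \<in> H2" for z :: "real \<Rightarrow> 'a"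
    using H2_imp_derivs[OF that] by (auto simp: H2_derivs_def)
  note w = wderiv_add_scaleR[OF g h, of c]
  show ?thesis
    unfolding H2_inner_def
      integral_inner_add_scaleR[OF L(2)[OF u] L(2)[OF g] L(2)[OF h] L(2)[OF gh] w(1)]
      integral_inner_add_scaleR[OF L(3)[OF u] L(3)[OF g] L(3)[OF h] L(3)[OF gh] w(2)]
      integral_inner_add_scaleR[OF L(1)[OF u] L(1)[OF g] L(1)[OF h] L(1)[OF gh] AE_I2[OF refl]]
    by (simp add: algebra_simps)
qed

lemma sqint_derivs_le:
  assumes "u \<in> H2"
  shows "sqint u \<le> (H2_norm u)\<^sup>2" "sqint (wderiv u) \<le> (H2_norm u)\<^sup>2"
    "sqint (wderiv (wderiv u)) \<le> (H2_norm u)\<^sup>2"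
  unfolding H2_norm_square[OF H2_imp_derivs[OF assms]] by simp_all

lemma sqrt_sqint_derivs_le:
  assumes "u \<in> H2"
  shows "sqrt (sqint u) \<le> H2_norm u" "sqrt (sqint (wderiv u)) \<le> H2_norm u"
    "sqrt (sqint (wderiv (wderiv u))) \<le> H2_norm u"
  using sqint_derivs_le[OF assms] by (auto intro!: real_le_lsqrt)

lemma H2_inner_bound:
  assumes u: "u \<in> H2" and v: "v \<in> H2"
  shows "\<bar>H2_inner u v\<bar> \<le> 3 * (H2_norm u * H2_norm v)"
proof -
  have L: "z \<in> L2" "wderiv z \<in> L2" "wderiv (wderiv z) \<in> L2" if "z \<in> H2" for z :: "real \<Rightarrow> 'a"
    using H2_imp_derivs[OF that] by (auto simp: H2_derivs_def)
  have *: "\<bar>LINT x|I01. p x \<bullet> q x\<bar> \<le> H2_norm u * H2_norm v"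
    if "p \<in> L2" "q \<in> L2" "sqrt (sqint p) \<le> H2_norm u" "sqrt (sqint q) \<le> H2_norm v" for p q :: "real \<Rightarrow> 'a"
  proof -
    have "\<bar>LINT x|I01. p x \<bullet> q x\<bar> \<le> sqrt (sqint p) * sqrt (sqint q)"
      using integral_weighted_inner_le[OF that(1,2), of 0] by simp
    also have "\<dots> \<le> H2_norm u * H2_norm v" using that by (intro mult_mono) auto
    finally show ?thesis .
  qed
  note s = sqrt_sqint_derivs_le[OF u] sqrt_sqint_derivs_le[OF v]
  show ?thesis
    using *[OF L(1)[OF u] L(1)[OF v] s(1,4)] *[OF L(2)[OF u] L(2)[OF v] s(2,5)]
      *[OF L(3)[OF u] L(3)[OF v] s(3,6)]
    unfolding H2_inner_def by linarith
qed

text \<open>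
  A single constant \<open>K\<close> serves both parts of \<open>F\<close>, so that the threshold for \<open>lam\<close> is an explicit
  polynomial in \<open>K\<close> and the bounds of the functions involved.
\<close>

locale quadratic_map =
  fixes B :: "'a::euclidean_space \<Rightarrow> 'a \<Rightarrow> 'a" and L F :: "'a \<Rightarrow> 'a" and K :: real
  assumes B: "bounded_bilinear B" and L: "bounded_linear L"
    and F_eq: "\<And>z. F z = B z z + L z"
    and K: "0 \<le> K" and norm_B: "\<And>z w. norm (B z w) \<le> K * (norm z * norm w)"
    and norm_L: "\<And>z. norm (L z) \<le> K * norm z"
begin

text \<open>
  The derivative of \<open>F\<close> at \<open>z\<close> in direction \<open>k\<close>.
\<close>

definition dF :: "'a \<Rightarrow> 'a \<Rightarrow> 'a" where
  "dF z k = B z k + B k z + L k"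

lemma F_expand: "F (z + k) = F z + dF z k + B k k"
proof -
  interpret B: bounded_bilinear B by (rule B)
  interpret L: bounded_linear L by (rule L)
  show ?thesis by (simp add: F_eq dF_def B.add_left B.add_right L.add)
qed

lemma dF_add_scaleR: "dF z (k + c *\<^sub>R l) = dF z k + c *\<^sub>R dF z l"
proof -
  interpret B: bounded_bilinear B by (rule B)
  interpret L: bounded_linear L by (rule L)
  show ?thesis
    by (simp add: dF_def B.add_left B.add_right L.add B.scaleR_left B.scaleR_right L.scaleR scaleR_add_right)
qed

lemma norm_dF_le:
  assumes "norm z \<le> S"
  shows "norm (dF z k) \<le> K * (2 * S + 1) * norm k"
proof -
  have "norm (dF z k) \<le> norm (B z k) + norm (B k z) + norm (L k)"
    unfolding dF_def by (intro order_trans[OF norm_triangle_ineq] add_mono order_refl)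
  also have "\<dots> \<le> K * (norm z * norm k) + K * (norm k * norm z) + K * norm k"
    by (intro add_mono norm_B norm_L)
  also have "\<dots> = (K * norm k) * (2 * norm z + 1)" by (simp add: algebra_simps)
  also have "\<dots> \<le> (K * norm k) * (2 * S + 1)" using K assms by (intro mult_left_mono) auto
  finally show ?thesis by (simp add: algebra_simps)
qed

lemma norm_F_le:
  assumes "norm z \<le> S"
  shows "norm (F z) \<le> K * (S * S + S)"
proof -
  have "norm (F z) \<le> K * (norm z * norm z) + K * norm z"
    unfolding F_eq by (intro order_trans[OF norm_triangle_ineq] add_mono norm_B norm_L)
  also have "\<dots> = K * (norm z * norm z + norm z)" by (simp add: algebra_simps)
  also have "\<dots> \<le> K * (S * S + S)"
    using K assms order_trans[OF norm_ge_zero assms] by (intro mult_left_mono add_mono mult_mono) auto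
  finally show ?thesis .
qed

lemma measurable_B:
  assumes "u \<in> borel_measurable I01" "v \<in> borel_measurable I01"
  shows "(\<lambda>x. B (u x) (v x)) \<in> borel_measurable I01"
proof (rule borel_measurable_continuous_Pair[OF assms])
  show "continuous_on UNIV (\<lambda>x. B (fst x) (snd x))"
    by (intro bounded_bilinear.continuous_on[OF B] continuous_intros)
qed

lemma measurable_L:
  assumes "u \<in> borel_measurable I01"
  shows "(\<lambda>x. L (u x)) \<in> borel_measurable I01"
  by (rule borel_measurable_continuous_on[OF _ assms])
     (intro bounded_linear.continuous_on[OF L] continuous_intros)

lemma measurable_F: "u \<in> borel_measurable I01 \<Longrightarrow> (\<lambda>x. F (u x)) \<in> borel_measurable I01"
  unfolding F_eq by (intro borel_measurable_add measurable_B measurable_L)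

lemma measurable_dF:
  "u \<in> borel_measurable I01 \<Longrightarrow> v \<in> borel_measurable I01 \<Longrightarrow> (\<lambda>x. dF (u x) (v x)) \<in> borel_measurable I01"
  unfolding dF_def by (intro borel_measurable_add measurable_B measurable_L)

text \<open>
  With \<open>A\<close> the residual of \<open>y\<close>, the residual of \<open>y + h\<close> is \<open>A + lin y h + quad h\<close>, in which \<open>lin\<close> is
  real-linear and \<open>quad\<close> is quadratic in \<open>h\<close>.
\<close>

definition residual :: "(real \<Rightarrow> 'a) \<Rightarrow> real \<Rightarrow> 'a" where
  "residual y x = wderiv (wderiv y) x + F (wderiv y x)"

definition lin :: "(real \<Rightarrow> 'a) \<Rightarrow> (real \<Rightarrow> 'a) \<Rightarrow> real \<Rightarrow> 'a" where
  "lin y h x = wderiv (wderiv h) x + dF (wderiv y x) (wderiv h x)"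

definition quad :: "(real \<Rightarrow> 'a) \<Rightarrow> real \<Rightarrow> 'a" where
  "quad h x = B (wderiv h x) (wderiv h x)"

lemma wderiv_L2:
  assumes "u \<in> H2"
  shows "wderiv u \<in> L2" "wderiv (wderiv u) \<in> L2"
  using H2_imp_derivs[OF assms] by (auto simp: H2_derivs_def)

lemma residual_L2:
  assumes y: "y \<in> H2"
  shows "residual y \<in> L2"
proof -
  have "(\<lambda>x. F (wderiv y x)) \<in> L2"
  proof (rule L2_bounded)
    show "(\<lambda>x. F (wderiv y x)) \<in> borel_measurable I01"
      by (intro measurable_F L2_measurable wderiv_L2 y)
    show "AE x in I01. norm (F (wderiv y x)) \<le> K * ((2 * H2_norm y) * (2 * H2_norm y) + 2 * H2_norm y)"
      using AE_wderiv_bound[OF y] by eventually_elim (rule norm_F_le)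
  qed
  then show ?thesis unfolding residual_def[abs_def] by (intro L2_add wderiv_L2 y)
qed

lemma dF_L2:
  assumes y: "y \<in> H2" and h: "h \<in> H2"
  shows "(\<lambda>x. dF (wderiv y x) (wderiv h x)) \<in> L2"
    and "sqint (\<lambda>x. dF (wderiv y x) (wderiv h x)) \<le> (K * (4 * H2_norm y + 1))\<^sup>2 * (H2_norm h)\<^sup>2"
proof -
  define M where "M = K * (4 * H2_norm y + 1)"
  have ae: "AE x in I01. norm (dF (wderiv y x) (wderiv h x)) \<le> M * norm (wderiv h x)"
    using AE_wderiv_bound[OF y] by eventually_elim (use norm_dF_le in \<open>fastforce simp: M_def\<close>)
  show L: "(\<lambda>x. dF (wderiv y x) (wderiv h x)) \<in> L2"
    by (rule L2_bound[OF wderiv_L2(1)[OF h] _ ae]) (intro measurable_dF L2_measurable wderiv_L2 y h)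
  have "sqint (\<lambda>x. dF (wderiv y x) (wderiv h x)) \<le> (LINT x|I01. M\<^sup>2 * (norm (wderiv h x))\<^sup>2)"
    unfolding sqint_def
  proof (rule integral_mono_AE)
    show "AE x in I01. (norm (dF (wderiv y x) (wderiv h x)))\<^sup>2 \<le> M\<^sup>2 * (norm (wderiv h x))\<^sup>2"
      using ae by eventually_elim (simp add: power_mult_distrib[symmetric] power_mono)
  qed (use L wderiv_L2(1)[OF h] in \<open>auto simp: L2_def\<close>)
  also have "\<dots> = M\<^sup>2 * sqint (wderiv h)" by (simp add: sqint_def)
  also have "\<dots> \<le> M\<^sup>2 * (H2_norm h)\<^sup>2" by (intro mult_left_mono sqint_derivs_le h) simp
  finally show "sqint (\<lambda>x. dF (wderiv y x) (wderiv h x)) \<le> (K * (4 * H2_norm y + 1))\<^sup>2 * (H2_norm h)\<^sup>2"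
    by (simp add: M_def)
qed

lemma lin_L2:
  assumes y: "y \<in> H2" and h: "h \<in> H2"
  shows "lin y h \<in> L2"
    and "sqint (lin y h) \<le> (2 + 2 * (K * (4 * H2_norm y + 1))\<^sup>2) * (H2_norm h)\<^sup>2"
proof -
  show "lin y h \<in> L2" unfolding lin_def[abs_def] by (intro L2_add wderiv_L2 h dF_L2 y)
  have "sqint (lin y h) \<le> 2 * sqint (wderiv (wderiv h)) + 2 * sqint (\<lambda>x. dF (wderiv y x) (wderiv h x))"
    unfolding lin_def[abs_def] by (intro sqint_add_le wderiv_L2 h dF_L2 y)
  also have "\<dots> \<le> 2 * (H2_norm h)\<^sup>2 + 2 * ((K * (4 * H2_norm y + 1))\<^sup>2 * (H2_norm h)\<^sup>2)"
    by (intro add_mono mult_left_mono sqint_derivs_le h dF_L2 y) auto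
  finally show "sqint (lin y h) \<le> (2 + 2 * (K * (4 * H2_norm y + 1))\<^sup>2) * (H2_norm h)\<^sup>2"
    by (simp add: algebra_simps)
qed

lemma quad_L2:
  assumes h: "h \<in> H2"
  shows "quad h \<in> L2" and "sqrt (sqint (quad h)) \<le> 4 * K * (H2_norm h)\<^sup>2"
proof -
  have ae: "AE x in I01. norm (quad h x) \<le> 4 * K * (H2_norm h)\<^sup>2"
    using AE_wderiv_bound[OF h]
  proof eventually_elim
    case (elim x)
    have "norm (quad h x) \<le> K * (norm (wderiv h x) * norm (wderiv h x))"
      unfolding quad_def by (rule norm_B)
    also have "\<dots> \<le> K * ((2 * H2_norm h) * (2 * H2_norm h))"
      using elim K by (intro mult_left_mono mult_mono) auto
    finally show ?case by (simp add: power2_eq_square)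
  qed
  show L: "quad h \<in> L2"
    by (rule L2_bounded[OF _ ae]) (unfold quad_def[abs_def], intro measurable_B L2_measurable wderiv_L2 h)
  have "sqint (quad h) \<le> (LINT x|I01. (4 * K * (H2_norm h)\<^sup>2)\<^sup>2)"
    unfolding sqint_def
  proof (rule integral_mono_AE)
    show "AE x in I01. (norm (quad h x))\<^sup>2 \<le> (4 * K * (H2_norm h)\<^sup>2)\<^sup>2"
      using ae by eventually_elim (simp add: power_mono)
  qed (use L in \<open>auto simp: L2_def\<close>)
  then show "sqrt (sqint (quad h)) \<le> 4 * K * (H2_norm h)\<^sup>2"
    using K by (intro real_le_lsqrt) auto
qed

text \<open>
  Expanding the square of the residual of \<open>y + h\<close>, the terms linear in \<open>h\<close>, together with that of the
  regularisation, make up the derivative; the weighted integral of the others is the remainder.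
\<close>

definition deriv_functional :: "real \<Rightarrow> real \<Rightarrow> (real \<Rightarrow> 'a) \<Rightarrow> (real \<Rightarrow> 'a) \<Rightarrow> real" where
  "deriv_functional lam a y h =
     exp (2 * lam) * (2 * (LINT x|I01. (residual y x \<bullet> lin y h x) * exp (- 2 * lam * x)))
     + a * (2 * H2_inner y h)"

definition remainder :: "real \<Rightarrow> (real \<Rightarrow> 'a) \<Rightarrow> (real \<Rightarrow> 'a) \<Rightarrow> real" where
  "remainder lam y h =
     (LINT x|I01. ((norm (lin y h x + quad h x))\<^sup>2 + 2 * (residual y x \<bullet> quad h x)) * exp (- 2 * lam * x))"

lemma functional_expand:
  assumes y: "y \<in> H2" and h: "h \<in> H2" and lam: "0 \<le> lam"
  shows "carleman_functional F lam a (\<lambda>x. y x + h x)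
    = carleman_functional F lam a y + deriv_functional lam a y h
      + (exp (2 * lam) * remainder lam y h + a * (H2_norm h)\<^sup>2)"
proof -
  have yh: "(\<lambda>x. y x + h x) \<in> H2" by (intro H2_add y h)
  note R = residual_L2[OF y] and N = lin_L2(1)[OF y h] and Q = quad_L2(1)[OF h]
  have LQ: "(\<lambda>x. lin y h x + quad h x) \<in> L2" by (intro L2_add N Q)
  define w where "w x = exp (- 2 * lam * x)" for x
  have mw: "w \<in> borel_measurable I01" unfolding w_def by (rule weight_measurable)
  have i: "integrable I01 (\<lambda>x. (norm (residual y x))\<^sup>2 * w x)"
      "integrable I01 (\<lambda>x. (residual y x \<bullet> lin y h x) * w x)"
      "integrable I01 (\<lambda>x. ((norm (lin y h x + quad h x))\<^sup>2 + 2 * (residual y x \<bullet> quad h x)) * w x)"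
    unfolding w_def
    by (intro integrable_weighted lam L2_square_integrable L2_inner_integrable
        Bochner_Integration.integrable_add integrable_mult_right R N Q LQ)+
  have "(LINT x|I01. (norm (residual (\<lambda>x. y x + h x) x))\<^sup>2 * w x)
      = (LINT x|I01. (norm (residual y x))\<^sup>2 * w x + 2 * ((residual y x \<bullet> lin y h x) * w x)
          + ((norm (lin y h x + quad h x))\<^sup>2 + 2 * (residual y x \<bullet> quad h x)) * w x)"
  proof (rule integral_cong_AE)
    have "AE x in I01. residual (\<lambda>x. y x + h x) x = residual y x + (lin y h x + quad h x)"
      using wderiv_add_scaleR[OF y h, of 1]
    proof eventually_elim
      case (elim x)
      then show ?case by (simp add: residual_def lin_def quad_def F_expand)
    qed
    then show "AE x in I01. (norm (residual (\<lambda>x. y x + h x) x))\<^sup>2 * w x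
      = (norm (residual y x))\<^sup>2 * w x + 2 * ((residual y x \<bullet> lin y h x) * w x)
          + ((norm (lin y h x + quad h x))\<^sup>2 + 2 * (residual y x \<bullet> quad h x)) * w x"
    proof eventually_elim
      case (elim x)
      have "(norm (residual y x + (lin y h x + quad h x)))\<^sup>2
          = (norm (residual y x))\<^sup>2 + 2 * (residual y x \<bullet> (lin y h x + quad h x)) + (norm (lin y h x + quad h x))\<^sup>2"
        by (simp add: power2_norm_eq_inner inner_add_left inner_add_right inner_commute)
      then show ?case unfolding elim by (simp add: inner_add_right algebra_simps)
    qed
    show "(\<lambda>x. (norm (residual (\<lambda>x. y x + h x) x))\<^sup>2 * w x) \<in> borel_measurable I01"
      using residual_L2[OF yh] mw by measurable
  qed (use i in \<open>auto dest!: borel_measurable_integrable\<close>)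
  also have "\<dots> = (LINT x|I01. (norm (residual y x))\<^sup>2 * w x)
      + 2 * (LINT x|I01. (residual y x \<bullet> lin y h x) * w x) + remainder lam y h"
    using i by (simp add: remainder_def w_def)
  finally show ?thesis
    unfolding carleman_functional_def H2_norm_add_square[OF y h]
    by (simp add: residual_def[symmetric] deriv_functional_def w_def algebra_simps)
qed

lemma deriv_functional_add_scaleR:
  assumes y: "y \<in> H2" and g: "g \<in> H2" and h: "h \<in> H2" and lam: "0 \<le> lam"
  shows "deriv_functional lam a y (\<lambda>x. g x + c *\<^sub>R h x)
    = deriv_functional lam a y g + c * deriv_functional lam a y h"
proof -
  have gh: "(\<lambda>x. g x + c *\<^sub>R h x) \<in> H2" by (intro H2_add H2_scaleR g h)
  define w where "w x = exp (- 2 * lam * x)" for x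
  have mw: "w \<in> borel_measurable I01" unfolding w_def by (rule weight_measurable)
  note R = residual_L2[OF y]
  have i: "integrable I01 (\<lambda>x. (residual y x \<bullet> lin y k x) * w x)" if "k \<in> H2" for k
    unfolding w_def by (intro integrable_weighted lam L2_inner_integrable R lin_L2 y that)
  have "(LINT x|I01. (residual y x \<bullet> lin y (\<lambda>x. g x + c *\<^sub>R h x) x) * w x)
      = (LINT x|I01. (residual y x \<bullet> lin y g x) * w x + c * ((residual y x \<bullet> lin y h x) * w x))"
  proof (rule integral_cong_AE)
    show "AE x in I01. (residual y x \<bullet> lin y (\<lambda>x. g x + c *\<^sub>R h x) x) * w x
       = (residual y x \<bullet> lin y g x) * w x + c * ((residual y x \<bullet> lin y h x) * w x)"
      using wderiv_add_scaleR[OF g h, of c]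
    proof eventually_elim
      case (elim x)
      then have "lin y (\<lambda>x. g x + c *\<^sub>R h x) x = lin y g x + c *\<^sub>R lin y h x"
        by (simp add: lin_def dF_add_scaleR scaleR_add_right)
      then show ?case by (simp add: inner_add_right algebra_simps)
    qed
  qed (use i[OF gh] i[OF g] i[OF h] in \<open>auto dest!: borel_measurable_integrable\<close>)
  also have "\<dots> = (LINT x|I01. (residual y x \<bullet> lin y g x) * w x)
      + c * (LINT x|I01. (residual y x \<bullet> lin y h x) * w x)"
    using i[OF g] i[OF h] by simp
  finally show ?thesis
    unfolding deriv_functional_def H2_inner_add_scaleR[OF y g h]
    by (simp add: w_def algebra_simps)
qed

lemma deriv_functional_bound:
  assumes y: "y \<in> H2" and lam: "0 \<le> lam"
  shows "\<exists>C. \<forall>h\<in>H2. \<bar>deriv_functional lam a y h\<bar> \<le> C * H2_norm h"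
proof -
  define M where "M = 2 + 2 * (K * (4 * H2_norm y + 1))\<^sup>2"
  define C where "C = exp (2 * lam) * (2 * (sqrt (sqint (residual y)) * sqrt M)) + \<bar>a\<bar> * (6 * H2_norm y)"
  have "\<bar>deriv_functional lam a y h\<bar> \<le> C * H2_norm h" if h: "h \<in> H2" for h
  proof -
    define I where "I = (LINT x|I01. (residual y x \<bullet> lin y h x) * exp (- 2 * lam * x))"
    have "\<bar>I\<bar> \<le> sqrt (sqint (residual y)) * sqrt (sqint (lin y h))"
      unfolding I_def by (intro integral_weighted_inner_le residual_L2 lin_L2 y h lam)
    also have "sqrt (sqint (lin y h)) \<le> sqrt (M * (H2_norm h)\<^sup>2)"
      using lin_L2(2)[OF y h] by (simp add: M_def)
    also have "\<dots> = sqrt M * H2_norm h" by (simp add: real_sqrt_mult)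
    finally have 1: "\<bar>I\<bar> \<le> sqrt (sqint (residual y)) * (sqrt M * H2_norm h)"
      by (simp add: mult_left_mono)
    have "\<bar>deriv_functional lam a y h\<bar> \<le> \<bar>exp (2 * lam) * (2 * I)\<bar> + \<bar>a * (2 * H2_inner y h)\<bar>"
      unfolding deriv_functional_def I_def by (rule abs_triangle_ineq)
    also have "\<dots> = exp (2 * lam) * (2 * \<bar>I\<bar>) + \<bar>a\<bar> * (2 * \<bar>H2_inner y h\<bar>)" by (simp add: abs_mult)
    also have "\<dots> \<le> exp (2 * lam) * (2 * (sqrt (sqint (residual y)) * (sqrt M * H2_norm h)))
        + \<bar>a\<bar> * (2 * (3 * (H2_norm y * H2_norm h)))"
      using 1 H2_inner_bound[OF y h] by (intro add_mono mult_left_mono) auto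
    also have "\<dots> = C * H2_norm h" by (simp add: C_def algebra_simps)
    finally show ?thesis .
  qed
  then show ?thesis by blast
qed

text \<open>
  The remainder is quadratic in the norm of \<open>h\<close>, because \<open>h'\<close> is bounded by that norm and so
  \<open>quad h\<close> is bounded by its square. The restriction to small \<open>h\<close> absorbs the fourth power that
  comes from the square of \<open>quad h\<close>.
\<close>

lemma remainder_upper:
  assumes y: "y \<in> H2" and lam: "0 \<le> lam"
  shows "\<exists>C\<ge>0. \<forall>h\<in>H2. H2_norm h \<le> 1 \<longrightarrow> \<bar>remainder lam y h\<bar> \<le> C * (H2_norm h)\<^sup>2"
proof -
  define M where "M = 2 + 2 * (K * (4 * H2_norm y + 1))\<^sup>2"
  define r where "r = sqrt (sqint (residual y))"
  have r0: "r \<ge> 0" by (simp add: r_def)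
  have M0: "M \<ge> 0" by (simp add: M_def)
  define C where "C = 2 * M + 2 * (4 * K)\<^sup>2 + 2 * (r * (4 * K))"
  have "\<bar>remainder lam y h\<bar> \<le> C * (H2_norm h)\<^sup>2" if h: "h \<in> H2" and h1: "H2_norm h \<le> 1" for h
  proof -
    define N where "N = (H2_norm h)\<^sup>2"
    have N: "0 \<le> N" "N \<le> 1" using h1 by (auto simp: N_def power_le_one)
    note R = residual_L2[OF y] and Ln = lin_L2(1)[OF y h] and Q = quad_L2(1)[OF h]
    have LQ: "(\<lambda>x. lin y h x + quad h x) \<in> L2" by (intro L2_add Ln Q)
    have q: "sqrt (sqint (quad h)) \<le> 4 * K * N" using quad_L2(2)[OF h] by (simp add: N_def)
    have q2: "sqint (quad h) \<le> (4 * K)\<^sup>2 * N"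
    proof -
      have "sqint (quad h) = (sqrt (sqint (quad h)))\<^sup>2" by simp
      also have "\<dots> \<le> (4 * K * N)\<^sup>2" using q by (intro power_mono) auto
      also have "\<dots> = (4 * K)\<^sup>2 * (N * N)" by (simp add: power2_eq_square)
      also have "\<dots> \<le> (4 * K)\<^sup>2 * (N * 1)" using N by (intro mult_left_mono) auto
      finally show ?thesis by simp
    qed
    have i: "integrable I01 (\<lambda>x. (norm (lin y h x + quad h x))\<^sup>2 * exp (- 2 * lam * x))"
      "integrable I01 (\<lambda>x. (residual y x \<bullet> quad h x) * exp (- 2 * lam * x))"
      by (intro integrable_weighted lam L2_square_integrable L2_inner_integrable R LQ Q)+
    have "remainder lam y h = (LINT x|I01. (norm (lin y h x + quad h x))\<^sup>2 * exp (- 2 * lam * x))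
        + 2 * (LINT x|I01. (residual y x \<bullet> quad h x) * exp (- 2 * lam * x))"
      unfolding remainder_def using i by (simp add: distrib_right mult.assoc)
    moreover have "\<bar>LINT x|I01. (norm (lin y h x + quad h x))\<^sup>2 * exp (- 2 * lam * x)\<bar> \<le> 2 * (M * N) + 2 * ((4 * K)\<^sup>2 * N)"
    proof -
      have "\<bar>LINT x|I01. (norm (lin y h x + quad h x))\<^sup>2 * exp (- 2 * lam * x)\<bar>
          \<le> sqint (\<lambda>x. lin y h x + quad h x)"
        using integral_weighted_inner_le[OF LQ LQ lam] by (simp add: power2_norm_eq_inner)
      also have "\<dots> \<le> 2 * sqint (lin y h) + 2 * sqint (quad h)" by (rule sqint_add_le[OF Ln Q])
      also have "\<dots> \<le> 2 * (M * N) + 2 * ((4 * K)\<^sup>2 * N)"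
        using lin_L2(2)[OF y h] q2 by (intro add_mono mult_left_mono) (auto simp: M_def N_def)
      finally show ?thesis .
    qed
    moreover have "\<bar>LINT x|I01. (residual y x \<bullet> quad h x) * exp (- 2 * lam * x)\<bar> \<le> r * (4 * K * N)"
    proof -
      have "\<bar>LINT x|I01. (residual y x \<bullet> quad h x) * exp (- 2 * lam * x)\<bar> \<le> r * sqrt (sqint (quad h))"
        unfolding r_def by (rule integral_weighted_inner_le[OF R Q lam])
      also have "\<dots> \<le> r * (4 * K * N)" by (intro mult_left_mono q r0)
      finally show ?thesis .
    qed
    ultimately have "\<bar>remainder lam y h\<bar> \<le> 2 * (M * N) + 2 * ((4 * K)\<^sup>2 * N) + 2 * (r * (4 * K * N))"
      by linarith
    also have "\<dots> = C * N" by (simp add: C_def algebra_simps)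
    finally show ?thesis by (simp add: N_def)
  qed
  moreover have "C \<ge> 0" using M0 r0 K by (simp add: C_def)
  ultimately show ?thesis by blast
qed

theorem frechet_functional:
  assumes y: "y \<in> H2" and lam: "0 \<le> lam"
  shows "has_frechet_H2_0 (carleman_functional F lam a) y (deriv_functional lam a y)"
  unfolding has_frechet_H2_0_def
proof (intro conjI ballI allI impI)
  have H2: "h \<in> H2" if "h \<in> H2_0" for h :: "real \<Rightarrow> 'a" using that by (simp add: H2_0_def)
  note lin = deriv_functional_add_scaleR[OF y _ _ lam]
  show "deriv_functional lam a y (\<lambda>x. g x + h x) = deriv_functional lam a y g + deriv_functional lam a y h"
    if "g \<in> H2_0" "h \<in> H2_0" for g h
    using lin[OF H2[OF that(1)] H2[OF that(2)], of a 1] by simp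
  show "deriv_functional lam a y (\<lambda>x. c *\<^sub>R h x) = c * deriv_functional lam a y h"
    if "h \<in> H2_0" for c h
    using lin[OF H2[OF that] H2[OF that], of a "c - 1"] by (simp add: algebra_simps)
  show "\<exists>C. \<forall>h\<in>H2_0. \<bar>deriv_functional lam a y h\<bar> \<le> C * H2_norm h"
    using deriv_functional_bound[OF y lam] H2 by blast
  fix e :: real assume "e > 0"
  obtain C where C: "C \<ge> 0" "\<And>h. h \<in> H2 \<Longrightarrow> H2_norm h \<le> 1 \<Longrightarrow> \<bar>remainder lam y h\<bar> \<le> C * (H2_norm h)\<^sup>2"
    using remainder_upper[OF y lam] by blast
  define D where "D = exp (2 * lam) * C + \<bar>a\<bar> + 1"
  have D: "D > 0" using C(1) by (simp add: D_def add_nonneg_pos)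
  show "\<exists>d>0. \<forall>h\<in>H2_0. H2_norm h < d \<longrightarrow>
      \<bar>carleman_functional F lam a (\<lambda>x. y x + h x) - carleman_functional F lam a y - deriv_functional lam a y h\<bar>
        \<le> e * H2_norm h"
  proof (intro exI[of _ "min 1 (e / D)"] conjI ballI impI)
    show "0 < min 1 (e / D)" using \<open>e > 0\<close> D by simp
    fix h :: "real \<Rightarrow> 'a" assume "h \<in> H2_0" and small: "H2_norm h < min 1 (e / D)"
    then have h: "h \<in> H2" by (simp add: H2)
    have "\<bar>carleman_functional F lam a (\<lambda>x. y x + h x) - carleman_functional F lam a y - deriv_functional lam a y h\<bar>
        = \<bar>exp (2 * lam) * remainder lam y h + a * (H2_norm h)\<^sup>2\<bar>"
      unfolding functional_expand[OF y h lam] by simp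
    also have "\<dots> \<le> exp (2 * lam) * \<bar>remainder lam y h\<bar> + \<bar>a\<bar> * (H2_norm h)\<^sup>2"
      by (rule order_trans[OF abs_triangle_ineq]) (simp add: abs_mult)
    also have "\<dots> \<le> exp (2 * lam) * (C * (H2_norm h)\<^sup>2) + \<bar>a\<bar> * (H2_norm h)\<^sup>2"
      using C(2)[OF h] small by (intro add_mono mult_left_mono) auto
    also have "\<dots> \<le> (D * H2_norm h) * H2_norm h"
      by (simp add: D_def power2_eq_square algebra_simps)
    also have "\<dots> \<le> e * H2_norm h"
      using small D by (intro mult_right_mono) (auto simp: field_simps)
    finally show "\<bar>carleman_functional F lam a (\<lambda>x. y x + h x) - carleman_functional F lam a y - deriv_functional lam a y h\<bar>
        \<le> e * H2_norm h" .
  qed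
qed

end

section \<open>Strict convexity\<close>

text \<open>
  On a multiple \<open>t h\<close> two derivatives differ by \<open>t (D h - D' h)\<close>, which must be \<open>o(t)\<close>.
\<close>

lemma has_frechet_H2_0_unique:
  assumes D: "has_frechet_H2_0 J y D" and D': "has_frechet_H2_0 J y D'" and h: "h \<in> H2_0"
  shows "D h = D' h"
proof (rule ccontr)
  assume "D h \<noteq> D' h"
  define s where "s = \<bar>D h - D' h\<bar>"
  have s: "s > 0" using \<open>D h \<noteq> D' h\<close> by (simp add: s_def)
  define N where "N = H2_norm h"
  have N: "N \<ge> 0" by (simp add: N_def)
  define e where "e = s / (4 * (N + 1))"
  have e: "e > 0" using s N by (simp add: e_def)
  obtain d1 where d1: "d1 > 0" "\<And>k. k \<in> H2_0 \<Longrightarrow> H2_norm k < d1 \<Longrightarrow>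
      \<bar>J (\<lambda>x. y x + k x) - J y - D k\<bar> \<le> e * H2_norm k"
    using D e unfolding has_frechet_H2_0_def by blast
  obtain d2 where d2: "d2 > 0" "\<And>k. k \<in> H2_0 \<Longrightarrow> H2_norm k < d2 \<Longrightarrow>
      \<bar>J (\<lambda>x. y x + k x) - J y - D' k\<bar> \<le> e * H2_norm k"
    using D' e unfolding has_frechet_H2_0_def by blast
  \<comment> \<open>Small enough for both derivatives; adding \<open>1\<close> to the norm covers the case that it vanishes.\<close>
  define t where "t = min d1 d2 / (N + 1)"
  have t: "t > 0" using d1 d2 N by (simp add: t_def)
  define k where "k x = t *\<^sub>R h x" for x
  have k: "k \<in> H2_0" unfolding k_def[abs_def] by (rule H2_0_scaleR[OF h])
  have nk: "H2_norm k = t * N"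
    unfolding k_def[abs_def] N_def using h t by (subst H2_norm_scaleR) (auto simp: H2_0_def)
  have "t * N < t * (N + 1)" using t by simp
  also have "t * (N + 1) = min d1 d2" using N by (simp add: t_def)
  finally have small: "H2_norm k < d1" "H2_norm k < d2" by (auto simp: nk)
  have "\<bar>D k - D' k\<bar> \<le> 2 * (e * H2_norm k)"
    using d1(2)[OF k small(1)] d2(2)[OF k small(2)] by linarith
  moreover have "D k = t * D h" "D' k = t * D' h"
    using D D' h unfolding has_frechet_H2_0_def k_def[abs_def] by auto
  then have "D k - D' k = t * (D h - D' h)" by (simp add: right_diff_distrib)
  then have "\<bar>D k - D' k\<bar> = t * s" using t by (simp add: s_def abs_mult)
  ultimately have "t * s \<le> t * (2 * (e * N))" by (simp add: nk mult.left_commute)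
  then have "s \<le> 2 * (e * N)" using t by simp
  also have "\<dots> = (s / 2) * (N / (N + 1))" using N by (simp add: e_def field_simps)
  also have "\<dots> \<le> (s / 2) * 1" using s N by (intro mult_left_mono) auto
  finally show False using s by simp
qed

lemma frechet_H2_0_eq:
  assumes "has_frechet_H2_0 J y D" "h \<in> H2_0"
  shows "frechet_H2_0 J y h = D h"
proof -
  have "has_frechet_H2_0 J y (frechet_H2_0 J y)"
    unfolding frechet_H2_0_def by (rule someI[of _ D]) (rule assms(1))
  then show ?thesis by (rule has_frechet_H2_0_unique[OF _ assms])
qed

context quadratic_map
begin

text \<open>
  Half of \<open>norm p\<^sup>2\<close> survives because \<open>norm p\<^sup>2\<close> is at most \<open>2 norm (p + r)\<^sup>2 + 2 norm r\<^sup>2\<close>. Everything else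
  is controlled by \<open>norm k\<^sup>2\<close>, with a coefficient that is affine in \<open>norm q\<close>. In the application \<open>p\<close>
  and \<open>q\<close> are the second derivatives of \<open>h\<close> and \<open>y\<close>; the latter has no
  pointwise bound, so that the coefficient is integrable but unbounded.
\<close>

lemma remainder_integrand_lower:
  assumes S: "norm z \<le> S" "norm k \<le> 2 * S"
  shows "(norm p)\<^sup>2 / 2 - ((K * (4 * S + 1))\<^sup>2 + 2 * K * (K * (S * S + S)) + 2 * K * norm q) * (norm k)\<^sup>2
       \<le> (norm (p + dF z k + B k k))\<^sup>2 + 2 * ((q + F z) \<bullet> B k k)"
proof -
  define r where "r = dF z k + B k k"
  have "norm r \<le> K * (2 * S + 1) * norm k + K * (norm k * norm k)"
    unfolding r_def by (intro order_trans[OF norm_triangle_ineq] add_mono norm_dF_le S norm_B)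
  also have "\<dots> \<le> K * (2 * S + 1) * norm k + K * (2 * S * norm k)"
    using S K by (intro add_mono mult_left_mono mult_right_mono) auto
  also have "\<dots> = K * (4 * S + 1) * norm k" by (simp add: algebra_simps)
  finally have "(norm r)\<^sup>2 \<le> (K * (4 * S + 1) * norm k)\<^sup>2" by (intro power_mono) auto
  then have 1: "(norm r)\<^sup>2 \<le> (K * (4 * S + 1))\<^sup>2 * (norm k)\<^sup>2" by (simp add: power_mult_distrib)
  have "norm p \<le> norm (p + r) + norm r" using norm_triangle_ineq4[of "p + r" r] by simp
  then have "(norm p)\<^sup>2 \<le> (norm (p + r) + norm r)\<^sup>2" by (intro power_mono) auto
  then have 2: "(norm p)\<^sup>2 \<le> 2 * (norm (p + r))\<^sup>2 + 2 * (norm r)\<^sup>2"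
    using sum_squares_bound[of "norm (p + r)" "norm r"] by (simp add: power2_sum)
  have 3: "norm (q + F z) \<le> norm q + K * (S * S + S)"
    by (intro order_trans[OF norm_triangle_ineq] add_left_mono norm_F_le S)
  have "\<bar>(q + F z) \<bullet> B k k\<bar> \<le> norm (q + F z) * norm (B k k)" by (rule Cauchy_Schwarz_ineq2)
  also have "\<dots> \<le> (norm q + K * (S * S + S)) * (K * (norm k * norm k))"
    using 3 norm_B[of k k]
      order_trans[OF norm_ge_zero S(1)] K
    by (intro mult_mono) auto
  also have "\<dots> = (2 * K * (K * (S * S + S)) + 2 * K * norm q) * (norm k)\<^sup>2 / 2"
    by (simp add: power2_eq_square algebra_simps)
  finally have 4: "\<bar>(q + F z) \<bullet> B k k\<bar>
      \<le> (2 * K * (K * (S * S + S)) + 2 * K * norm q) * (norm k)\<^sup>2 / 2" .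
  have 5: "((K * (4 * S + 1))\<^sup>2 + 2 * K * (K * (S * S + S)) + 2 * K * norm q) * (norm k)\<^sup>2
      = (K * (4 * S + 1))\<^sup>2 * (norm k)\<^sup>2
        + (2 * K * (K * (S * S + S)) + 2 * K * norm q) * (norm k)\<^sup>2"
    by (simp only: distrib_right add.assoc)
  have 6: "p + dF z k + B k k = p + r" by (simp add: r_def)
  show ?thesis unfolding 5 6 using 1 2 4 by linarith
qed

text \<open>
  Beyond this value of the parameter the Carleman gain absorbs half of the positive term. The
  argument \<open>N\<close> is a bound for the \<open>H\<^sup>2\<close> norms of the two points compared: \<open>2 N\<close> then bounds their first
  derivatives, and \<open>N\<close> the \<open>L\<^sup>1\<close> norm of the second derivative.
\<close>

definition threshold :: "real \<Rightarrow> real" where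
  "threshold N = 2 + 2 *
     ((K * (4 * (2 * N) + 1))\<^sup>2 + 2 * K * (K * (2 * N * (2 * N) + 2 * N)) + 2 * K * N)"

lemma threshold_gt_1: "0 \<le> N \<Longrightarrow> 1 < threshold N"
proof -
  assume "0 \<le> N"
  then have "0 \<le> 2 * ((K * (4 * (2 * N) + 1))\<^sup>2 + 2 * K * (K * (2 * N * (2 * N) + 2 * N)) + 2 * K * N)"
    using K by simp
  then show ?thesis unfolding threshold_def by linarith
qed

text \<open>
  The pointwise Carleman estimate bounds the unfavourable part of the integrand by \<open>V = W / (2 lam)\<close>
  times an integrable coefficient, where \<open>W\<close> is the weighted integral of \<open>norm h''\<^sup>2\<close>. For large \<open>lam\<close>
  its integral is at most \<open>W / 4\<close>, half of the favourable part. Finally the factor \<open>exp (2 lam)\<close> in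
  front of the integral makes the weight at least \<open>1\<close> on the whole interval.
\<close>

lemma remainder_lower:
  assumes y: "y \<in> H2" "H2_norm y \<le> N" and h: "h \<in> H2_0" "H2_norm h \<le> 2 * N"
    and lam: "threshold N \<le> lam"
  shows "sqint (wderiv (wderiv h)) / 4 \<le> exp (2 * lam) * remainder lam y h"
proof -
  have N: "0 \<le> N" using order_trans[OF H2_norm_nonneg y(2)] .
  have lam0: "lam > 0" "0 \<le> lam" using lam threshold_gt_1[OF N] by auto
  have hH: "h \<in> H2" using h(1) by (simp add: H2_0_def)
  define p where "p = wderiv (wderiv h)"
  define w where "w x = exp (- 2 * lam * x)" for x
  define W where "W = (LINT x|I01. (norm (p x))\<^sup>2 * w x)"
  define V where "V = W / (2 * lam)"
  define A where "A = (K * (4 * (2 * N) + 1))\<^sup>2 + 2 * K * (K * (2 * N * (2 * N) + 2 * N))"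
  have pL: "p \<in> L2" unfolding p_def by (rule wderiv_L2[OF hH])
  have W0: "W \<ge> 0" by (simp add: W_def w_def)
  have V0: "V \<ge> 0" using W0 lam0 by (simp add: V_def)
  have A0: "A \<ge> 0" unfolding A_def using K N by simp
  have iW: "integrable I01 (\<lambda>x. (norm (p x))\<^sup>2 * w x)"
    unfolding w_def by (intro integrable_weighted lam0 L2_square_integrable pL)
  have iy: "integrable I01 (\<lambda>x. norm (wderiv (wderiv y) x))"
    by (intro integrable_norm L2_integrable wderiv_L2 y)
  have iG: "integrable I01 (\<lambda>x. ((norm (lin y h x + quad h x))\<^sup>2 + 2 * (residual y x \<bullet> quad h x)) * w x)"
    unfolding w_def
    by (intro integrable_weighted lam0 L2_square_integrable L2_inner_integrable L2_add
        Bochner_Integration.integrable_add integrable_mult_right lin_L2 quad_L2 residual_L2 y hH)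
  have "AE x in I01. (norm (p x))\<^sup>2 * w x / 2 - (A + 2 * K * norm (wderiv (wderiv y) x)) * V
      \<le> ((norm (lin y h x + quad h x))\<^sup>2 + 2 * (residual y x \<bullet> quad h x)) * w x"
    using AE_wderiv_bound[OF y(1)] AE_wderiv_bound[OF hH] H2_0_wderiv_prim[OF h(1)] AE_space[of I01]
  proof eventually_elim
    case (elim x)
    have w0: "w x \<ge> 0" by (simp add: w_def)
    have c: "(norm (wderiv h x))\<^sup>2 * w x \<le> V"
      using carleman_pointwise[OF pL lam0(1), of x] elim by (simp add: V_def W_def w_def p_def)
    define E where "E = A + 2 * K * norm (wderiv (wderiv y) x)"
    have E0: "E \<ge> 0" using A0 K by (simp add: E_def)
    have "(norm (p x))\<^sup>2 / 2 - E * (norm (wderiv h x))\<^sup>2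
        \<le> (norm (lin y h x + quad h x))\<^sup>2 + 2 * (residual y x \<bullet> quad h x)"
      unfolding E_def A_def lin_def quad_def residual_def p_def
      by (rule remainder_integrand_lower) (use elim y h in auto)
    then have "((norm (p x))\<^sup>2 / 2 - E * (norm (wderiv h x))\<^sup>2) * w x
        \<le> ((norm (lin y h x + quad h x))\<^sup>2 + 2 * (residual y x \<bullet> quad h x)) * w x"
      by (rule mult_right_mono[OF _ w0])
    moreover have "E * ((norm (wderiv h x))\<^sup>2 * w x) \<le> E * V" by (rule mult_left_mono[OF c E0])
    ultimately show ?case unfolding E_def[symmetric] by (simp add: left_diff_distrib mult.assoc)
  qed
  then have "(LINT x|I01. (norm (p x))\<^sup>2 * w x / 2 - (A + 2 * K * norm (wderiv (wderiv y) x)) * V)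
      \<le> remainder lam y h"
    unfolding remainder_def w_def[symmetric]
    by (rule integral_mono_AE[rotated 2]) (use iW iy iG in auto)
  also have "(LINT x|I01. (norm (p x))\<^sup>2 * w x / 2 - (A + 2 * K * norm (wderiv (wderiv y) x)) * V)
      = W / 2 - (A + 2 * K * (LINT x|I01. norm (wderiv (wderiv y) x))) * V"
    using iW iy by (simp add: W_def)
  finally have 1: "W / 2 - (A + 2 * K * (LINT x|I01. norm (wderiv (wderiv y) x))) * V \<le> remainder lam y h" .
  have "(LINT x|I01. norm (wderiv (wderiv y) x)) \<le> N"
    using integral_norm_le_sqrt_sqint[OF wderiv_L2(2)[OF y(1)]] sqrt_sqint_derivs_le(3)[OF y(1)] y(2)
    by linarith
  then have "(A + 2 * K * (LINT x|I01. norm (wderiv (wderiv y) x))) * V \<le> (A + 2 * K * N) * V"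
    using K V0 by (intro mult_right_mono add_left_mono mult_left_mono) auto
  also have "\<dots> \<le> W / 4"
  proof -
    have "(A + 2 * K * N) * W \<le> (lam / 2) * W"
      using lam by (intro mult_right_mono W0) (simp add: threshold_def A_def)
    then show ?thesis using lam0 by (simp add: V_def field_simps)
  qed
  finally have 2: "W / 4 \<le> remainder lam y h" using 1 by linarith
  have "sqint p \<le> (LINT x|I01. exp (2 * lam) * ((norm (p x))\<^sup>2 * w x))"
    unfolding sqint_def
  proof (rule integral_mono)
    show "(norm (p x))\<^sup>2 \<le> exp (2 * lam) * ((norm (p x))\<^sup>2 * w x)" if "x \<in> space I01" for x
    proof -
      have "1 \<le> exp (2 * lam) * w x"
        using that lam0 by (simp add: w_def exp_add[symmetric])
      then have "(norm (p x))\<^sup>2 * 1 \<le> (norm (p x))\<^sup>2 * (exp (2 * lam) * w x)"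
        by (intro mult_left_mono) auto
      then show ?thesis by (simp add: mult.left_commute)
    qed
  qed (use iW L2_square_integrable[OF pL] in auto)
  also have "\<dots> = exp (2 * lam) * W" by (simp add: W_def)
  also have "\<dots> \<le> exp (2 * lam) * (4 * remainder lam y h)" using 2 by (intro mult_left_mono) auto
  finally show ?thesis by (simp add: p_def)
qed

text \<open>
  The constant is \<open>1 / 4\<close> from the lower bound of the remainder, times \<open>1 / 3\<close> from the Poincare
  inequality. The regularisation term adds the nonnegative amount \<open>a * (H2_norm h)\<^sup>2\<close>.
\<close>

theorem strict_convexity:
  assumes a: "0 < a" and y: "y1 \<in> H2" "y2 \<in> H2"
    and n: "H2_norm y1 \<le> N" "H2_norm y2 \<le> N" and lam: "threshold N \<le> lam"
    and h: "(\<lambda>x. y2 x - y1 x) \<in> H2_0"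
  shows "carleman_functional F lam a y2 - carleman_functional F lam a y1
      - frechet_H2_0 (carleman_functional F lam a) y1 (\<lambda>x. y2 x - y1 x)
    \<ge> 1 / 12 * (H2_norm (\<lambda>x. y2 x - y1 x))\<^sup>2"
proof -
  have N: "0 \<le> N" using order_trans[OF H2_norm_nonneg n(1)] .
  define k where "k x = y2 x - y1 x" for x
  have k0: "k \<in> H2_0" using h by (simp add: k_def[abs_def])
  then have kH: "k \<in> H2" by (simp add: H2_0_def)
  have lam0: "0 \<le> lam" using lam threshold_gt_1[OF N] by linarith
  have "(H2_norm k)\<^sup>2 \<le> 2 * (H2_norm y2)\<^sup>2 + 2 * (H2_norm y1)\<^sup>2"
    using H2_norm_add_square_le[OF y(2) H2_scaleR[OF y(1), of "-1"]] H2_norm_scaleR[OF y(1), of "-1"]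
    by (simp add: k_def[abs_def])
  also have "\<dots> \<le> 2 * N\<^sup>2 + 2 * N\<^sup>2" using n by (intro add_mono mult_left_mono power_mono) auto
  also have "\<dots> = (2 * N)\<^sup>2" by (simp add: power2_eq_square)
  finally have "H2_norm k \<le> 2 * N" by (rule power2_le_imp_le) (use N in simp)
  note lower = remainder_lower[OF y(1) n(1) k0 this lam]
  have "y2 = (\<lambda>x. y1 x + k x)" by (simp add: k_def)
  then have "carleman_functional F lam a y2 - carleman_functional F lam a y1
      - frechet_H2_0 (carleman_functional F lam a) y1 k
      = exp (2 * lam) * remainder lam y1 k + a * (H2_norm k)\<^sup>2"
    unfolding frechet_H2_0_eq[OF frechet_functional[OF y(1) lam0] k0]
    using functional_expand[OF y(1) kH lam0] by simp
  moreover have "1 / 12 * (H2_norm k)\<^sup>2 \<le> exp (2 * lam) * remainder lam y1 k"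
    using lower H2_0_norm_le[OF k0] by linarith
  moreover have "0 \<le> a * (H2_norm k)\<^sup>2" using a by simp
  ultimately show ?thesis unfolding k_def[abs_def] by linarith
qed

end

section \<open>The map given by the basis\<close>

lemma linear_matrix_vector_complex:
  fixes A :: "complex ^ 'n ^ 'm" and G :: "'b::real_vector \<Rightarrow> complex ^ 'n"
  assumes "linear G"
  shows "linear (\<lambda>z. A *v G z)"
proof (rule linearI)
  show "A *v G (x + y) = A *v G x + A *v G y" for x y
    by (simp add: linear_add[OF assms] matrix_vector_right_distrib)
  show "A *v G (r *\<^sub>R x) = r *\<^sub>R (A *v G x)" for r x
    by (simp add: linear_scale[OF assms] vec_eq_iff matrix_vector_mult_def scaleR_sum_right)
qed

text \<open>
  The integrals of the basis functions enter as coefficients: the map is a real-bilinear map on the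
  diagonal plus a real-linear map, and both are bounded because the space has finite dimension.
\<close>

lemma F_map_quadratic:
  "\<exists>B L K. quadratic_map B L (F_map klo khi :: complex ^ 'n::{finite,linorder} \<Rightarrow> _) K"
proof -
  define c where "c n m s = complex_of_real (integral {klo..khi} (\<lambda>k.
        (2 * k\<^sup>2 * deriv (psi klo khi (idx n)) k * psi klo khi (idx m) k
          + 2 * k * psi klo khi (idx n) k * psi klo khi (idx m) k) * psi klo khi (idx s) k))"
    for n m s :: 'n
  define d where "d n s = complex_of_real (integral {klo..khi} (\<lambda>k.
        (k * deriv (psi klo khi (idx n)) k + psi klo khi (idx n) k) * psi klo khi (idx s) k))"
    for n s :: 'n
  define G :: "complex ^ 'n::{finite,linorder} \<Rightarrow> complex ^ 'n::{finite,linorder} \<Rightarrow> complex ^ 'n::{finite,linorder}"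
    where "G z w = (\<chi> s. \<Sum>n\<in>UNIV. \<Sum>m\<in>UNIV. z $ n * w $ m * c n m s)" for z w
  define H :: "complex ^ 'n::{finite,linorder} \<Rightarrow> complex ^ 'n::{finite,linorder}"
    where "H z = (\<chi> s. - (2 * \<i> * (\<Sum>n\<in>UNIV. z $ n * d n s)))" for z
  define M :: "complex ^ 'n::{finite,linorder} ^ 'n::{finite,linorder}" where "M = matrix_inv (M_mat klo khi)"
  define B where "B z w = M *v G z w" for z w
  define L where "L z = M *v H z" for z
  have "linear (\<lambda>z. G z w)" for w
    by (rule linearI)
       (simp_all add: G_def vec_eq_iff algebra_simps sum.distrib scaleR_sum_right)
  moreover have "linear (\<lambda>w. G z w)" for z
    by (rule linearI)
       (simp_all add: G_def vec_eq_iff algebra_simps sum.distrib scaleR_sum_right)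
  ultimately have "bilinear B"
    unfolding bilinear_def B_def by (auto intro: linear_matrix_vector_complex)
  then have B: "bounded_bilinear B" by (simp add: bilinear_conv_bounded_bilinear)
  have "linear H"
    by (rule linearI)
       (simp_all add: H_def vec_eq_iff algebra_simps sum.distrib scaleR_sum_right sum_distrib_left)
  then have "linear L" unfolding L_def by (rule linear_matrix_vector_complex)
  then have L: "bounded_linear L" by (simp add: linear_conv_bounded_linear)
  have F: "F_map klo khi z = B z z + L z" for z
  proof -
    have "F_tilde klo khi z = G z z + H z"
      by (simp add: F_tilde_def G_def H_def c_def d_def vec_eq_iff)
    then show ?thesis by (simp add: F_map_def B_def L_def M_def matrix_vector_right_distrib)
  qed
  obtain K1 where K1: "0 \<le> K1" "\<And>z w. norm (B z w) \<le> norm z * norm w * K1"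
    using bounded_bilinear.nonneg_bounded[OF B] by blast
  obtain K2 where K2: "0 \<le> K2" "\<And>z. norm (L z) \<le> norm z * K2"
    using bounded_linear.nonneg_bounded[OF L] by blast
  have "quadratic_map B L (F_map klo khi) (K1 + K2)"
  proof (rule quadratic_map.intro[OF B L F])
    show "0 \<le> K1 + K2" using K1(1) K2(1) by simp
    show "norm (B z w) \<le> (K1 + K2) * (norm z * norm w)" for z w
    proof -
      have "norm z * norm w * K1 \<le> norm z * norm w * (K1 + K2)"
        using K2(1) by (intro mult_left_mono) auto
      with K1(2)[of z w] show ?thesis by (simp add: mult.commute)
    qed
    show "norm (L z) \<le> (K1 + K2) * norm z" for z
    proof -
      have "norm z * K2 \<le> norm z * (K1 + K2)" using K1(1) by (intro mult_left_mono) auto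
      with K2(2)[of z] show ?thesis by (simp add: mult.commute)
    qed
  qed
  then show ?thesis by blast
qed

lemma J_fun_eq: "J_fun klo khi lam a = carleman_functional (F_map klo khi) lam a"
  by (rule ext) (simp add: J_fun_def carleman_functional_def)

theorem theorem4p1:
  fixes klo khi R :: real
  assumes "0 < klo" and "klo < khi" and "0 < R"
  shows
    "(\<forall>c (f0 :: complex ^ 'n::{finite,linorder}) f1. cutoff c \<longrightarrow>
        (\<forall>a lam. 0 < a \<and> a < 1 \<and> 1 \<le> lam \<longrightarrow>
          (\<forall>y\<in>B_set c (2 * R) f0 f1. \<exists>D. has_frechet_H2_0 (J_fun klo khi lam a) y D))) \<and>
     (\<exists>C1>0. \<forall>c (f0 :: complex ^ 'n::{finite,linorder}) f1. cutoff c \<longrightarrow>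
        (\<exists>lam1>1. \<forall>a lam. 0 < a \<and> a < 1 \<and> lam1 \<le> lam \<longrightarrow>
          (\<forall>y1\<in>H2_closure (B_set c R f0 f1). \<forall>y2\<in>H2_closure (B_set c R f0 f1).
             J_fun klo khi lam a y2 - J_fun klo khi lam a y1
               - frechet_H2_0 (J_fun klo khi lam a) y1 (\<lambda>x. y2 x - y1 x)
             \<ge> C1 * (H2_norm (\<lambda>x. y2 x - y1 x))\<^sup>2)))"
proof -
  obtain B L K where "quadratic_map B L (F_map klo khi :: complex ^ 'n::{finite,linorder} \<Rightarrow> _) K"
    using F_map_quadratic by blast
  then interpret quadratic_map B L "F_map klo khi :: complex ^ 'n::{finite,linorder} \<Rightarrow> _" K .
  show ?thesis
  proof (intro conjI allI impI ballI)
    fix c and a lam :: real and f0 f1 :: "complex ^ 'n::{finite,linorder}" and y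
    assume "0 < a \<and> a < 1 \<and> 1 \<le> lam" "y \<in> B_set c (2 * R) f0 f1"
    then show "\<exists>D. has_frechet_H2_0 (J_fun klo khi lam a) y D"
      unfolding J_fun_eq using frechet_functional[of y lam a] by (auto simp: B_set_def)
  next
    show "\<exists>C1>0. \<forall>c (f0 :: complex ^ 'n::{finite,linorder}) f1. cutoff c \<longrightarrow>
        (\<exists>lam1>1. \<forall>a lam. 0 < a \<and> a < 1 \<and> lam1 \<le> lam \<longrightarrow>
          (\<forall>y1\<in>H2_closure (B_set c R f0 f1). \<forall>y2\<in>H2_closure (B_set c R f0 f1).
             J_fun klo khi lam a y2 - J_fun klo khi lam a y1
               - frechet_H2_0 (J_fun klo khi lam a) y1 (\<lambda>x. y2 x - y1 x)
             \<ge> C1 * (H2_norm (\<lambda>x. y2 x - y1 x))\<^sup>2))"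
    proof (rule exI[of _ "1 / 12"], intro conjI allI impI)
      fix c and f0 f1 :: "complex ^ 'n::{finite,linorder}" assume "cutoff c"
      obtain N where N: "N \<ge> 0" "\<And>y. y \<in> H2_closure (B_set c R f0 f1) \<Longrightarrow> H2_norm y \<le> N"
        using H2_closure_B_bounded[OF \<open>cutoff c\<close>, of R f0 f1] by blast
      have "J_fun klo khi lam a y2 - J_fun klo khi lam a y1
          - frechet_H2_0 (J_fun klo khi lam a) y1 (\<lambda>x. y2 x - y1 x)
          \<ge> 1 / 12 * (H2_norm (\<lambda>x. y2 x - y1 x))\<^sup>2"
        if "0 < a" "threshold N \<le> lam"
          "y1 \<in> H2_closure (B_set c R f0 f1)" "y2 \<in> H2_closure (B_set c R f0 f1)" for a lam y1 y2
        unfolding J_fun_eq using that N(2)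
        by (intro strict_convexity[of _ _ _ N] H2_closure_B_diff H2_closure_B_traces(1)) auto
      then show "\<exists>lam1>1. \<forall>a lam. 0 < a \<and> a < 1 \<and> lam1 \<le> lam \<longrightarrow>
          (\<forall>y1\<in>H2_closure (B_set c R f0 f1). \<forall>y2\<in>H2_closure (B_set c R f0 f1).
             J_fun klo khi lam a y2 - J_fun klo khi lam a y1
               - frechet_H2_0 (J_fun klo khi lam a) y1 (\<lambda>x. y2 x - y1 x)
             \<ge> 1 / 12 * (H2_norm (\<lambda>x. y2 x - y1 x))\<^sup>2)"
        using threshold_gt_1[OF N(1)] by blast
    qed simp
  qed
qed

end
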